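(* For finitely presented monoids, the word problem and the $c$-conjugacy problem are independent. That is, there exist finitely presented monoids $M_1$ and $M_2$ such that for $M_1$ the word problem is decidable and the $c$-conjugacy problem is undecidable, and for $M_2$ the $c$-conjugacy problem is decidable and the word problem is undecidable.
   Context: A finitely presented monoid is a monoid $M=M(\Sigma;R)=\Sigma^*/\rho_R$, where $\Sigma$ is a finite alphabet, $R\subseteq\Sigma^*\times\Sigma^*$ is finite, and $\rho_R$ is the smallest congruence on $\Sigma^*$ containing $R$; $[u]_M$ denotes the element represented by $u\in\Sigma^*$. For a monoid $M$ with zero and $a\in M\setminus\{0\}$, let $\mathbb P(a)=\{g\in M:(\forall m\in M)\ mag=0\Rightarrow ma=0\}$, and let $\mathbb P(0)=\{0\}$; if $M$ has no zero, $\mathbb P(a)=M$ for all $a\in M$. Define $a\sim_c b$ to mean: there exist $g\in\mathbb P(a)$ and $h\in\mathbb P(b)$ with $ag=gb$ and $bh=ha$. The $c$-conjugacy problem (resp. word problem) for $M=M(\Sigma;R)$ is decidable if there is an algorithm that, given any pair $(u,v)$ of words in $\Sigma^*$, returns YES if $[u]_M\sim_c[v]_M$ (resp. $[u]_M=[v]_M$) and NO otherwise; otherwise it is undecidable. *)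

theory Defs
  imports "HOL-Algebra.Group" "HOL-Library.Nat_Bijection"
begin

section \<open>Finitely presented monoids\<close>

definition word_congruence :: "'a set \<Rightarrow> ('a list \<times> 'a list) set \<Rightarrow> bool" where
  "word_congruence \<Sigma> \<rho> \<longleftrightarrow> equiv (lists \<Sigma>) \<rho> \<and>
     (\<forall>u v x y. (u, v) \<in> \<rho> \<longrightarrow> (x, y) \<in> \<rho> \<longrightarrow> (u @ x, v @ y) \<in> \<rho>)"

definition gen_congruence :: "'a set \<Rightarrow> ('a list \<times> 'a list) set \<Rightarrow> ('a list \<times> 'a list) set" where
  "gen_congruence \<Sigma> R = \<Inter>{\<rho>. word_congruence \<Sigma> \<rho> \<and> R \<subseteq> \<rho>}"

definition word_class :: "'a set \<Rightarrow> ('a list \<times> 'a list) set \<Rightarrow> 'a list \<Rightarrow> 'a list set" where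
  "word_class \<Sigma> R u = gen_congruence \<Sigma> R `` {u}"

definition finite_presentation :: "'a set \<Rightarrow> ('a list \<times> 'a list) set \<Rightarrow> bool" where
  "finite_presentation \<Sigma> R \<longleftrightarrow> finite \<Sigma> \<and> finite R \<and> R \<subseteq> lists \<Sigma> \<times> lists \<Sigma>"

text \<open>The product of two classes is the class of the concatenation of representatives; it is
  written as a union over all representatives (see \<open>presented_monoid_mult\<close> below).\<close>

definition presented_monoid :: "'a set \<Rightarrow> ('a list \<times> 'a list) set \<Rightarrow> 'a list set monoid" where
  "presented_monoid \<Sigma> R =
     \<lparr>carrier = lists \<Sigma> // gen_congruence \<Sigma> R,
      mult = (\<lambda>X Y. \<Union>x\<in>X. \<Union>y\<in>Y. word_class \<Sigma> R (x @ y)),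
      one = word_class \<Sigma> R []\<rparr>"

lemma word_congruence_gen_congruence:
  assumes "R \<subseteq> lists \<Sigma> \<times> lists \<Sigma>"
  shows "word_congruence \<Sigma> (gen_congruence \<Sigma> R)"
proof -
  have full: "word_congruence \<Sigma> (lists \<Sigma> \<times> lists \<Sigma>)"
    by (auto simp: word_congruence_def equiv_def refl_on_def sym_def trans_def)
  have sub: "gen_congruence \<Sigma> R \<subseteq> lists \<Sigma> \<times> lists \<Sigma>"
    using full assms unfolding gen_congruence_def by blast
  have mem: "p \<in> gen_congruence \<Sigma> R \<longleftrightarrow> (\<forall>\<rho>. word_congruence \<Sigma> \<rho> \<and> R \<subseteq> \<rho> \<longrightarrow> p \<in> \<rho>)" for p
    by (simp add: gen_congruence_def)
  have "refl_on (lists \<Sigma>) (gen_congruence \<Sigma> R)"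
    by (rule refl_onI) (simp add: mem word_congruence_def equiv_def refl_on_def)
  moreover have "sym (gen_congruence \<Sigma> R)"
    by (rule symI) (simp add: mem word_congruence_def equiv_def sym_def)
  moreover have "trans (gen_congruence \<Sigma> R)"
  proof (rule transI)
    fix u v w assume uv: "(u, v) \<in> gen_congruence \<Sigma> R" and vw: "(v, w) \<in> gen_congruence \<Sigma> R"
    have "(u, w) \<in> \<rho>" if "word_congruence \<Sigma> \<rho> \<and> R \<subseteq> \<rho>" for \<rho>
    proof -
      have "trans \<rho>" using that by (simp add: word_congruence_def equiv_def)
      moreover have "(u, v) \<in> \<rho>" "(v, w) \<in> \<rho>" using that uv vw mem by auto
      ultimately show ?thesis by (rule transD)
    qed
    then show "(u, w) \<in> gen_congruence \<Sigma> R" using mem by blast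
  qed
  moreover have "\<forall>u v x y. (u, v) \<in> gen_congruence \<Sigma> R \<longrightarrow> (x, y) \<in> gen_congruence \<Sigma> R
      \<longrightarrow> (u @ x, v @ y) \<in> gen_congruence \<Sigma> R"
    by (simp add: mem word_congruence_def)
  ultimately show ?thesis
    using sub unfolding word_congruence_def equiv_def by blast
qed

lemma word_class_eq_iff:
  assumes "R \<subseteq> lists \<Sigma> \<times> lists \<Sigma>" "u \<in> lists \<Sigma>" "v \<in> lists \<Sigma>"
  shows "word_class \<Sigma> R u = word_class \<Sigma> R v \<longleftrightarrow> (u, v) \<in> gen_congruence \<Sigma> R"
  using word_congruence_gen_congruence[OF assms(1)] assms(2,3)
  unfolding word_class_def word_congruence_def by (metis eq_equiv_class_iff)

lemma presented_monoid_mult: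
  assumes R: "R \<subseteq> lists \<Sigma> \<times> lists \<Sigma>" and u: "u \<in> lists \<Sigma>" and v: "v \<in> lists \<Sigma>"
  shows "word_class \<Sigma> R u \<otimes>\<^bsub>presented_monoid \<Sigma> R\<^esub> word_class \<Sigma> R v = word_class \<Sigma> R (u @ v)"
proof -
  let ?C = "gen_congruence \<Sigma> R"
  have eq: "equiv (lists \<Sigma>) ?C"
    and comp: "\<And>u v x y. (u, v) \<in> ?C \<Longrightarrow> (x, y) \<in> ?C \<Longrightarrow> (u @ x, v @ y) \<in> ?C"
    using word_congruence_gen_congruence[OF R] unfolding word_congruence_def by blast+
  have same: "word_class \<Sigma> R (x @ y) = word_class \<Sigma> R (u @ v)"
    if "x \<in> word_class \<Sigma> R u" "y \<in> word_class \<Sigma> R v" for x y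
    using that comp[of u x v y] equiv_class_eq[OF eq, of "u @ v" "x @ y"]
    by (auto simp: word_class_def)
  have self: "u \<in> word_class \<Sigma> R u" "v \<in> word_class \<Sigma> R v"
    using equiv_class_self[OF eq] u v unfolding word_class_def by blast+
  have "(\<Union>x\<in>word_class \<Sigma> R u. \<Union>y\<in>word_class \<Sigma> R v. word_class \<Sigma> R (x @ y)) =
      (\<Union>x\<in>word_class \<Sigma> R u. \<Union>y\<in>word_class \<Sigma> R v. word_class \<Sigma> R (u @ v))"
    by (intro SUP_cong refl same)
  also have "\<dots> = word_class \<Sigma> R (u @ v)"
    using self by blast
  finally show ?thesis
    by (simp add: presented_monoid_def)
qed

lemma monoid_presented_monoid:
  assumes R: "R \<subseteq> lists \<Sigma> \<times> lists \<Sigma>"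
  shows "Group.monoid (presented_monoid \<Sigma> R)"
proof -
  let ?M = "presented_monoid \<Sigma> R"
  have cls: "carrier ?M = word_class \<Sigma> R ` lists \<Sigma>"
    by (auto simp: presented_monoid_def quotient_def word_class_def)
  have one: "\<one>\<^bsub>?M\<^esub> = word_class \<Sigma> R []"
    by (simp add: presented_monoid_def)
  note mult = presented_monoid_mult[OF R]
  show ?thesis
  proof (rule monoidI)
    fix x y assume "x \<in> carrier ?M" "y \<in> carrier ?M"
    then obtain u v where "u \<in> lists \<Sigma>" "v \<in> lists \<Sigma>"
      "x = word_class \<Sigma> R u" "y = word_class \<Sigma> R v"
      unfolding cls by blast
    then show "x \<otimes>\<^bsub>?M\<^esub> y \<in> carrier ?M"
      by (simp only: mult cls) simp
  next
    show "\<one>\<^bsub>?M\<^esub> \<in> carrier ?M"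
      by (simp add: one cls)
  next
    fix x y z assume "x \<in> carrier ?M" "y \<in> carrier ?M" "z \<in> carrier ?M"
    then obtain u v w where "u \<in> lists \<Sigma>" "v \<in> lists \<Sigma>" "w \<in> lists \<Sigma>"
      "x = word_class \<Sigma> R u" "y = word_class \<Sigma> R v" "z = word_class \<Sigma> R w"
      unfolding cls by blast
    then show "x \<otimes>\<^bsub>?M\<^esub> y \<otimes>\<^bsub>?M\<^esub> z = x \<otimes>\<^bsub>?M\<^esub> (y \<otimes>\<^bsub>?M\<^esub> z)"
      using mult[of u v] mult[of v w] mult[of "u @ v" w] mult[of u "v @ w"] by simp
  next
    fix x assume "x \<in> carrier ?M"
    then obtain u where "u \<in> lists \<Sigma>" "x = word_class \<Sigma> R u"
      unfolding cls by blast
    then show "\<one>\<^bsub>?M\<^esub> \<otimes>\<^bsub>?M\<^esub> x = x" "x \<otimes>\<^bsub>?M\<^esub> \<one>\<^bsub>?M\<^esub> = x"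
      using mult[of "[]" u] mult[of u "[]"] one by simp_all
  qed
qed

section \<open>The relation of \<open>c\<close>-conjugacy\<close>

definition is_zero :: "('a, 'b) monoid_scheme \<Rightarrow> 'a \<Rightarrow> bool" where
  "is_zero M z \<longleftrightarrow> z \<in> carrier M \<and> (\<forall>x\<in>carrier M. z \<otimes>\<^bsub>M\<^esub> x = z \<and> x \<otimes>\<^bsub>M\<^esub> z = z)"

definition c_conjugators :: "('a, 'b) monoid_scheme \<Rightarrow> 'a \<Rightarrow> 'a set" where
  "c_conjugators M a =
     (if \<nexists>z. is_zero M z then carrier M
      else if is_zero M a then {a}
      else {g \<in> carrier M. \<forall>m\<in>carrier M.
              is_zero M ((m \<otimes>\<^bsub>M\<^esub> a) \<otimes>\<^bsub>M\<^esub> g) \<longrightarrow> is_zero M (m \<otimes>\<^bsub>M\<^esub> a)})"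

definition c_conjugate :: "('a, 'b) monoid_scheme \<Rightarrow> 'a \<Rightarrow> 'a \<Rightarrow> bool" where
  "c_conjugate M a b \<longleftrightarrow>
     (\<exists>g\<in>c_conjugators M a. \<exists>h\<in>c_conjugators M b.
        a \<otimes>\<^bsub>M\<^esub> g = g \<otimes>\<^bsub>M\<^esub> b \<and> b \<otimes>\<^bsub>M\<^esub> h = h \<otimes>\<^bsub>M\<^esub> a)"

section \<open>Algorithms: partial recursive functions\<close>

text \<open>Programs are terms for Kleene's \<open>\<mu>\<close>-recursive functions. Arities are not tracked: a term
  applied to an argument list of unsuitable length just has no value.\<close>

datatype recf =
    Zero
  | Succ
  | Proj nat
  | Comp recf "recf list"
  | PrimRec recf recf
  | Mu recf

inductive rec_eval :: "recf \<Rightarrow> nat list \<Rightarrow> nat \<Rightarrow> bool" where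
  rec_eval_Zero: "rec_eval Zero xs 0"
| rec_eval_Succ: "rec_eval Succ [x] (Suc x)"
| rec_eval_Proj: "i < length xs \<Longrightarrow> rec_eval (Proj i) xs (xs ! i)"
| rec_eval_Comp: "list_all2 (\<lambda>g y. rec_eval g xs y) gs ys \<Longrightarrow> rec_eval f ys z
    \<Longrightarrow> rec_eval (Comp f gs) xs z"
| rec_eval_PrimRec_0: "rec_eval f xs z \<Longrightarrow> rec_eval (PrimRec f g) (0 # xs) z"
| rec_eval_PrimRec_Suc: "rec_eval (PrimRec f g) (n # xs) y \<Longrightarrow> rec_eval g (n # y # xs) z
    \<Longrightarrow> rec_eval (PrimRec f g) (Suc n # xs) z"
| rec_eval_Mu: "rec_eval f (n # xs) 0 \<Longrightarrow> (\<And>m. m < n \<Longrightarrow> \<exists>y. rec_eval f (m # xs) (Suc y))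
    \<Longrightarrow> rec_eval (Mu f) xs n"

inductive_cases rec_eval_ZeroE: "rec_eval Zero xs z"
inductive_cases rec_eval_SuccE: "rec_eval Succ xs z"
inductive_cases rec_eval_ProjE: "rec_eval (Proj i) xs z"
inductive_cases rec_eval_CompE: "rec_eval (Comp f gs) xs z"
inductive_cases rec_eval_PrimRec_0E: "rec_eval (PrimRec f g) (0 # xs) z"
inductive_cases rec_eval_PrimRec_SucE: "rec_eval (PrimRec f g) (Suc n # xs) z"
inductive_cases rec_eval_MuE: "rec_eval (Mu f) xs z"

lemma rec_eval_deterministic: "rec_eval f xs y \<Longrightarrow> rec_eval f xs z \<Longrightarrow> y = z"
proof (induction arbitrary: z rule: rec_eval.induct)
  case (rec_eval_Comp xs gs ys f w)
  from rec_eval_Comp.prems obtain ys' where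
    ys': "list_all2 (\<lambda>g y. rec_eval g xs y) gs ys'" "rec_eval f ys' z"
    by (auto elim: rec_eval_CompE)
  have "ys = ys'"
    using rec_eval_Comp.IH(1) ys'(1)
    by (intro nth_equalityI) (auto simp: list_all2_conv_all_nth)
  then show ?case using rec_eval_Comp.IH(2) ys'(2) by blast
next
  case (rec_eval_Mu f n xs)
  from rec_eval_Mu.prems have z: "rec_eval f (z # xs) 0"
    "\<And>m. m < z \<Longrightarrow> \<exists>y. rec_eval f (m # xs) (Suc y)"
    by (auto elim: rec_eval_MuE)
  show ?case
  proof (rule linorder_cases[of n z])
    assume "n < z"
    then show ?thesis using z(2) rec_eval_Mu.IH(1) by (metis nat.distinct(1))
  next
    assume "z < n"
    then show ?thesis using z(1) rec_eval_Mu.IH(2) by (metis nat.distinct(1))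
  qed
next
  case (rec_eval_PrimRec_Suc f g n xs y w)
  from rec_eval_PrimRec_Suc.prems obtain y' where
    "rec_eval (PrimRec f g) (n # xs) y'" "rec_eval g (n # y' # xs) z"
    by (auto elim: rec_eval_PrimRec_SucE)
  then show ?case using rec_eval_PrimRec_Suc.IH by blast
next
  case (rec_eval_Zero xs)
  then show ?case by (rule rec_eval_ZeroE) simp
next
  case (rec_eval_Succ x)
  then show ?case by (rule rec_eval_SuccE) simp
next
  case (rec_eval_Proj i xs)
  from rec_eval_Proj.prems show ?case by (rule rec_eval_ProjE) simp
next
  case (rec_eval_PrimRec_0 f xs w g)
  from rec_eval_PrimRec_0.prems have "rec_eval f xs z" by (rule rec_eval_PrimRec_0E)
  then show ?case by (rule rec_eval_PrimRec_0.IH)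
qed

text \<open>Letters are natural numbers, and a word is handed to a program through its code
  \<^const>\<open>list_encode\<close>. The answers YES and NO are the values 1 and 0. Nothing is required of
  the program on inputs that are not codes of words over \<open>\<Sigma>\<close>.\<close>

definition decidable_on_words :: "nat set \<Rightarrow> (nat list \<Rightarrow> nat list \<Rightarrow> bool) \<Rightarrow> bool" where
  "decidable_on_words \<Sigma> P \<longleftrightarrow>
     (\<exists>f. \<forall>u\<in>lists \<Sigma>. \<forall>v\<in>lists \<Sigma>.
        rec_eval f [list_encode u, list_encode v] (if P u v then 1 else 0))"

definition word_problem_decidable :: "nat set \<Rightarrow> (nat list \<times> nat list) set \<Rightarrow> bool" where
  "word_problem_decidable \<Sigma> R \<longleftrightarrow>
     decidable_on_words \<Sigma> (\<lambda>u v. word_class \<Sigma> R u = word_class \<Sigma> R v)"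

definition c_conjugacy_problem_decidable :: "nat set \<Rightarrow> (nat list \<times> nat list) set \<Rightarrow> bool" where
  "c_conjugacy_problem_decidable \<Sigma> R \<longleftrightarrow>
     decidable_on_words \<Sigma>
       (\<lambda>u v. c_conjugate (presented_monoid \<Sigma> R) (word_class \<Sigma> R u) (word_class \<Sigma> R v))"

end

theory Submission
  imports Defs
begin

text \<open>Both monoids come from one finite string rewriting system \<open>S\<close> which interprets programs given as
  part of the word: for every \<open>\<mu>\<close>-recursive \<open>f\<close> there is a word \<open>w\<close> such that \<open># , 1\<^sup>n w\<close> has the
  normal form \<open># HALT\<close> if \<open>f n = 0\<close> and another normal form if \<open>f n > 0\<close>. Every left-hand side is a pair of
  a letter from a set and a letter outside it; hence redexes never overlap, and \<open>S\<close> is confluent.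
  A diagonal argument shows that it is undecidable whether a word is equivalent to \<open># HALT\<close>.

  For \<open>M\<^sub>2\<close>, take the relations of \<open>S\<close> and a new letter \<open>e\<close> with \<open>ae = e = ea\<close> for all \<open>a \<noteq> e\<close>. There is
  no zero, and two words are conjugate iff they contain equally many \<open>e\<close>, whereas the word problem on
  words without \<open>e\<close> is that of \<open>S\<close>.

  For \<open>M\<^sub>1\<close>, one step of \<open>S\<close> is carried out by a signal \<open>f\<close> that passes through a word \<open>u\<close> from right to
  left, \<open>u f = f u'\<close>. As each letter and signal can be exchanged by exactly one relation, normal forms are
  computable. But conjugating \<open>u\<close> into \<open># HALT\<close> amounts to a computation of \<open>S\<close>. Further signals lead
  back from \<open># HALT\<close> to all words \<open># w\<close>.\<close>

section \<open>Computable functions on lists of numbers\<close>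

text \<open>Programs may run forever, so \<open>S\<close> does not terminate. Hence more than
  confluence is used: two different steps from one word are joined by exactly one step on each side,
  so all reductions of a word to its normal form have the same length. This random descent lets a
  signal choose its own redexes: every pass that changes the word brings it nearer to its normal
  form, if there is one.

  With left-hand sides of length two, a program reaches only the register next to it; hence the
  queue. Program letters are used up when they act; hence a loop is unrolled by copying its body.

  \<open>c\<close>-conjugacy asks for conjugators in both directions, but a computation is not
  reversible. The signals leading back from \<open># HALT\<close> make one direction always true and
  must offer no shortcut in the other. This is ensured by the letter 0, which computations never
  contain, and by the fact that a conjugating signal must leave a word as it entered. Neither monoid
  has a zero, since the relations preserve the number of signals, respectively of \<open>e\<close>;
  so every element is an admissible conjugator.\<close>

definition computable :: "nat \<Rightarrow> (nat list \<Rightarrow> nat) \<Rightarrow> bool" where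
  "computable k h \<longleftrightarrow> (\<exists>f. \<forall>xs. length xs = k \<longrightarrow> rec_eval f xs (h xs))"

lemma computable_cong:
  assumes "computable k h" "\<And>xs. length xs = k \<Longrightarrow> h xs = h' xs"
  shows "computable k h'"
  using assms unfolding computable_def by metis

lemma computable_nth [intro]: "i < k \<Longrightarrow> computable k (\<lambda>xs. xs ! i)"
  unfolding computable_def by (metis rec_eval_Proj)

lemma computable_comp:
  assumes g: "computable (length hs) g" and hs: "\<And>h. h \<in> set hs \<Longrightarrow> computable k h"
  shows "computable k (\<lambda>xs. g (map (\<lambda>h. h xs) hs))"
proof -
  obtain f where f: "\<And>ys. length ys = length hs \<Longrightarrow> rec_eval f ys (g ys)"
    using g unfolding computable_def by blast
  have "\<exists>fs. \<forall>xs. length xs = k \<longrightarrow> list_all2 (\<lambda>f y. rec_eval f xs y) fs (map (\<lambda>h. h xs) hs)"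
    using hs
  proof (induction hs)
    case (Cons h hs)
    then obtain fs where "\<forall>xs. length xs = k \<longrightarrow>
        list_all2 (\<lambda>f y. rec_eval f xs y) fs (map (\<lambda>h. h xs) hs)"
      by auto
    moreover obtain f where "\<forall>xs. length xs = k \<longrightarrow> rec_eval f xs (h xs)"
      using Cons.prems[of h] unfolding computable_def by auto
    ultimately show ?case
      by (intro exI[of _ "f # fs"]) simp
  qed auto
  then obtain fs where fs: "\<And>xs. length xs = k \<Longrightarrow>
      list_all2 (\<lambda>f y. rec_eval f xs y) fs (map (\<lambda>h. h xs) hs)"
    by blast
  have "rec_eval (Comp f fs) xs (g (map (\<lambda>h. h xs) hs))" if "length xs = k" for xs
    using rec_eval_Comp[OF fs[OF that] f] by simp
  then show ?thesis unfolding computable_def by blast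
qed

lemma computable_comp1:
  assumes "computable 1 (\<lambda>xs. g (xs ! 0))" "computable k h"
  shows "computable k (\<lambda>xs. g (h xs))"
  using computable_comp[of "[h]" "\<lambda>xs. g (xs ! 0)" k] assms by simp

lemma computable_comp2:
  assumes "computable 2 (\<lambda>xs. g (xs ! 0) (xs ! 1))" "computable k h1" "computable k h2"
  shows "computable k (\<lambda>xs. g (h1 xs) (h2 xs))"
  using computable_comp[of "[h1, h2]" "\<lambda>xs. g (xs ! 0) (xs ! 1)" k] assms
  by (auto simp: numeral_2_eq_2)

lemma computable_comp3:
  assumes "computable 3 (\<lambda>xs. g (xs ! 0) (xs ! 1) (xs ! 2))"
    "computable k h1" "computable k h2" "computable k h3"
  shows "computable k (\<lambda>xs. g (h1 xs) (h2 xs) (h3 xs))"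
  using computable_comp[of "[h1, h2, h3]" "\<lambda>xs. g (xs ! 0) (xs ! 1) (xs ! 2)" k] assms
  by (auto simp: numeral_3_eq_3 numeral_2_eq_2)

lemma computable_Suc:
  assumes "computable k h" shows "computable k (\<lambda>xs. Suc (h xs))"
proof (rule computable_comp1[where g = Suc, OF _ assms])
  have "rec_eval Succ xs (Suc (xs ! 0))" if "length xs = 1" for xs
    using that rec_eval_Succ by (auto simp: length_Suc_conv)
  then show "computable 1 (\<lambda>xs. Suc (xs ! 0))" unfolding computable_def by blast
qed

lemma computable_const: "computable k (\<lambda>xs. c)"
proof (induction c)
  case 0
  show ?case unfolding computable_def using rec_eval_Zero by blast
qed (rule computable_Suc)

lemma computable_rec_nat:
  assumes "computable k b" "computable (Suc (Suc k)) s"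
  shows "computable (Suc k) (\<lambda>xs. rec_nat (b (tl xs)) (\<lambda>i y. s (i # y # tl xs)) (hd xs))"
proof -
  obtain f g where f: "\<And>xs. length xs = k \<Longrightarrow> rec_eval f xs (b xs)"
    and g: "\<And>xs. length xs = Suc (Suc k) \<Longrightarrow> rec_eval g xs (s xs)"
    using assms unfolding computable_def by blast
  have "rec_eval (PrimRec f g) (n # xs) (rec_nat (b xs) (\<lambda>i y. s (i # y # xs)) n)"
    if "length xs = k" for n xs
    by (induction n) (use that f g in \<open>auto intro: rec_eval_PrimRec_0 rec_eval_PrimRec_Suc\<close>)
  then have "rec_eval (PrimRec f g) xs (rec_nat (b (tl xs)) (\<lambda>i y. s (i # y # tl xs)) (hd xs))"
    if "length xs = Suc k" for xs
    using that by (cases xs) auto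
  then show ?thesis unfolding computable_def by blast
qed

lemma computable_rec_nat1:
  assumes "computable 2 (\<lambda>xs. s (xs ! 0) (xs ! 1))"
  shows "computable 1 (\<lambda>xs. rec_nat c s (xs ! 0))"
  using computable_rec_nat[OF computable_const, of 0 "\<lambda>xs. s (xs ! 0) (xs ! 1)" c] assms
  by (auto elim!: computable_cong simp: numeral_2_eq_2 length_Suc_conv)

lemma computable_rec_nat2:
  assumes "computable 1 (\<lambda>xs. b (xs ! 0))" "computable 3 (\<lambda>xs. s (xs ! 0) (xs ! 1) (xs ! 2))"
  shows "computable 2 (\<lambda>xs. rec_nat (b (xs ! 1)) (\<lambda>i y. s i y (xs ! 1)) (xs ! 0))"
  using computable_rec_nat[of 1 "\<lambda>xs. b (xs ! 0)" "\<lambda>xs. s (xs ! 0) (xs ! 1) (xs ! 2)"] assms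
  by (auto elim!: computable_cong simp: numeral_2_eq_2 numeral_3_eq_3 length_Suc_conv)

section \<open>Iteration, arithmetic and case distinctions\<close>

lemma computable_funpow:
  assumes "computable 1 (\<lambda>xs. s (xs ! 0))" "computable k n" "computable k a"
  shows "computable k (\<lambda>xs. (s ^^ n xs) (a xs))"
proof (rule computable_comp2[OF _ assms(2,3)])
  have "computable 2 (\<lambda>xs. rec_nat (xs ! 1) (\<lambda>i y. s y) (xs ! 0))"
    by (rule computable_rec_nat2[of "\<lambda>x. x" "\<lambda>i y x. s y"])
      (auto intro!: computable_comp1[of s, OF assms(1)])
  moreover have "rec_nat a (\<lambda>i y. s y) m = (s ^^ m) a" for a m
    by (induction m) auto
  ultimately show "computable 2 (\<lambda>xs. (s ^^ (xs ! 0)) (xs ! 1))" by simp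
qed

lemma computable_add:
  assumes "computable k a" "computable k b" shows "computable k (\<lambda>xs. a xs + b xs)"
proof -
  have "(Suc ^^ m) n = m + n" for m n :: nat by (induction m) auto
  then show ?thesis
    using computable_funpow[of Suc k a b] assms computable_Suc[OF computable_nth, of 0 1] by simp
qed

lemma computable_pred:
  assumes "computable k a" shows "computable k (\<lambda>xs. a xs - 1)"
proof (rule computable_comp1[where g = "\<lambda>x. x - 1", OF _ assms])
  have "rec_nat 0 (\<lambda>i y. i) m = m - 1" for m :: nat by (cases m) auto
  then show "computable 1 (\<lambda>xs. xs ! 0 - 1)"
    using computable_rec_nat1[of "\<lambda>i y. i" 0] computable_nth[of 0 2] by simp
qed

lemma computable_diff:
  assumes "computable k a" "computable k b" shows "computable k (\<lambda>xs. a xs - b xs)"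
proof -
  have "((\<lambda>x. x - 1) ^^ m) n = n - m" for m n :: nat by (induction m) auto
  then show ?thesis
    using computable_funpow[of "\<lambda>x. x - 1" k b a] assms computable_pred[OF computable_nth, of 0 1]
    by simp
qed

lemma computable_if_zero:
  assumes "computable k a" "computable k b" "computable k c"
  shows "computable k (\<lambda>xs. if a xs = 0 then b xs else c xs)"
proof (rule computable_comp3[OF _ assms])
  have "computable 3 (\<lambda>xs. rec_nat (tl xs ! 0) (\<lambda>i y. (i # y # tl xs) ! 3) (hd xs))"
    using computable_rec_nat[of 2 "\<lambda>xs. xs ! 0" "\<lambda>xs. xs ! 3"]
    by (auto simp: numeral_3_eq_3 numeral_2_eq_2)
  moreover have "rec_nat x (\<lambda>i y. z) m = (if m = 0 then x else z)" for x z m :: nat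
    by (cases m) auto
  ultimately show "computable 3 (\<lambda>xs. if xs ! 0 = 0 then xs ! 1 else xs ! 2)"
    by (auto elim!: computable_cong simp: numeral_3_eq_3 numeral_2_eq_2 length_Suc_conv)
qed

lemma computable_if_le:
  assumes "computable k a" "computable k b" "computable k c" "computable k d"
  shows "computable k (\<lambda>xs. if a xs \<le> b xs then c xs else d xs)"
  using computable_if_zero[OF computable_diff[OF assms(1,2)] assms(3,4)] by simp

lemma computable_if_eq:
  assumes "computable k a" "computable k b" "computable k c" "computable k d"
  shows "computable k (\<lambda>xs. if a xs = b xs then c xs else d xs)"
  by (rule computable_cong[OF computable_if_le[OF assms(1,2)
        computable_if_le[OF assms(2,1,3,4)] assms(4)]]) auto

section \<open>The pairing function and its inverse\<close>

lemma computable_triangle: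
  assumes "computable k a" shows "computable k (\<lambda>xs. triangle (a xs))"
proof (rule computable_comp1[where g = triangle, OF _ assms])
  have "rec_nat 0 (\<lambda>i y. y + Suc i) m = triangle m" for m
    by (induction m) auto
  then show "computable 1 (\<lambda>xs. triangle (xs ! 0))"
    using computable_rec_nat1[of "\<lambda>i y. y + Suc i" 0]
      computable_add[OF computable_nth computable_Suc[OF computable_nth], of 1 2 0]
    by simp
qed

lemma computable_prod_encode:
  "computable k a \<Longrightarrow> computable k b \<Longrightarrow> computable k (\<lambda>xs. prod_encode (a xs, b xs))"
  unfolding prod_encode_def by (simp add: computable_add computable_triangle)

text \<open>As \<open>prod_encode (a, b) = triangle (a + b) + a\<close>, decoding \<open>n\<close>
  amounts to finding the largest \<open>y\<close> with \<open>triangle y \<le> n\<close>. This root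
  grows by at most one when \<open>n\<close> does, which makes it primitive recursive.\<close>

definition triangle_root :: "nat \<Rightarrow> nat" where
  "triangle_root = rec_nat 0 (\<lambda>i y. if triangle (Suc y) \<le> Suc i then Suc y else y)"

lemma triangle_root_bounds: "triangle (triangle_root n) \<le> n \<and> n < triangle (Suc (triangle_root n))"
proof (induction n)
  case (Suc n)
  then show ?case by (auto simp: triangle_root_def)
qed (simp add: triangle_root_def)

lemma triangle_mono: "m \<le> n \<Longrightarrow> triangle m \<le> triangle n"
  by (induction n rule: nat_induct) (auto simp: le_Suc_eq)

lemma triangle_root_prod_encode: "triangle_root (prod_encode (a, b)) = a + b"
proof -
  let ?r = "triangle_root (prod_encode (a, b))"
  have *: "triangle ?r \<le> triangle (a + b) + a" "triangle (a + b) + a < triangle (Suc ?r)"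
    using triangle_root_bounds[of "prod_encode (a, b)"] by (auto simp: prod_encode_def)
  have "a + b < Suc ?r"
    using * triangle_mono[of "Suc ?r" "a + b"] by linarith
  moreover have "?r < Suc (a + b)"
    using *(1) triangle_mono[of "Suc (a + b)" ?r] by (cases "Suc (a + b) \<le> ?r") auto
  ultimately show ?thesis by simp
qed

abbreviation pfst :: "nat \<Rightarrow> nat" where "pfst n \<equiv> fst (prod_decode n)"
abbreviation psnd :: "nat \<Rightarrow> nat" where "psnd n \<equiv> snd (prod_decode n)"

lemma prod_decode_triangle_root:
  "pfst n = n - triangle (triangle_root n)"
  "psnd n = triangle_root n - (n - triangle (triangle_root n))"
proof -
  obtain a b where "n = prod_encode (a, b)"
    by (metis prod_decode_inverse surj_pair)
  then show "pfst n = n - triangle (triangle_root n)"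
    "psnd n = triangle_root n - (n - triangle (triangle_root n))"
    using triangle_root_prod_encode[of a b] by (simp_all add: prod_encode_inverse)
      (simp_all add: prod_encode_def)
qed

lemma computable_prod_decode:
  assumes "computable k a"
  shows "computable k (\<lambda>xs. pfst (a xs))" "computable k (\<lambda>xs. psnd (a xs))"
proof -
  have "computable 1 (\<lambda>xs. triangle_root (xs ! 0))"
    unfolding triangle_root_def
    by (intro computable_rec_nat1 computable_if_le computable_triangle computable_Suc computable_nth)
      auto
  from computable_comp1[of triangle_root, OF this assms] have "computable k (\<lambda>xs. triangle_root (a xs))" .
  then show "computable k (\<lambda>xs. pfst (a xs))" "computable k (\<lambda>xs. psnd (a xs))"
    using assms by (simp_all add: prod_decode_triangle_root computable_diff computable_triangle)
qed

section \<open>Codes of lists\<close>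

lemma computable_list_cons:
  "computable k a \<Longrightarrow> computable k b \<Longrightarrow>
     computable k (\<lambda>xs. list_encode (a xs # list_decode (b xs)))"
  by (simp add: computable_Suc computable_prod_encode)

lemma length_le_list_encode: "length xs \<le> list_encode xs"
proof (induction xs)
  case (Cons x xs)
  then show ?case using le_prod_encode_2[of "list_encode xs" x] by simp
qed simp

text \<open>The state pairs the accumulator with the code of the remaining list. A code bounds the
  length of its list, so iterating as often as the code says exhausts the list; states with an empty
  rest stay fixed.\<close>

lemma computable_foldl:
  assumes s: "computable 2 (\<lambda>xs. s (xs ! 0) (xs ! 1))"
    and a: "computable k a" and l: "computable k l"
  shows "computable k (\<lambda>xs. foldl s (a xs) (list_decode (l xs)))"
proof -
  \<comment> \<open>The code of a nonempty list is the successor of a pair, and 0 is the code of the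
    empty list.\<close>
  define t where "t st = (if psnd st = 0 then st else
    prod_encode (s (pfst st) (pfst (psnd st - 1)), psnd (psnd st - 1)))" for st
  have t: "(t ^^ n) (prod_encode (x, list_encode ys)) =
      prod_encode (foldl s x (take n ys), list_encode (drop n ys))" for n x ys
  proof (induction n arbitrary: x ys)
    case (Suc n)
    have "t (prod_encode (x, list_encode [])) = prod_encode (x, list_encode [])"
      "t (prod_encode (x, list_encode (y # ys))) = prod_encode (s x y, list_encode ys)" for y ys
      by (simp_all add: t_def)
    then show ?case
      using Suc by (cases ys) (simp_all add: funpow_Suc_right del: funpow.simps list_encode.simps)
  qed simp
  have t': "pfst ((t ^^ m) (prod_encode (x, m))) = foldl s x (list_decode m)" for x m
  proof -
    have "length (list_decode m) \<le> m"
      using length_le_list_encode[of "list_decode m"] by simp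
    then show ?thesis using t[of m x "list_decode m"] by simp
  qed
  have "computable 1 (\<lambda>xs. t (xs ! 0))"
    unfolding t_def
    by (intro computable_if_zero computable_prod_encode computable_comp2[OF s]
        computable_prod_decode computable_pred computable_nth) auto
  from computable_prod_decode(1)[OF computable_funpow[OF this l computable_prod_encode[OF a l]]]
  show ?thesis using t' by simp
qed

lemma foldl_Cons_conv: "foldl (\<lambda>c x. list_encode (x # list_decode c)) (list_encode ys) xs
    = list_encode (rev xs @ ys)"
  by (induction xs arbitrary: ys) (simp_all del: list_encode.simps)

lemma computable_rev_append:
  assumes "computable k a" "computable k b"
  shows "computable k (\<lambda>xs. list_encode (rev (list_decode (a xs)) @ list_decode (b xs)))"
proof -
  have "computable k (\<lambda>xs. foldl (\<lambda>c x. list_encode (x # list_decode c)) (b xs) (list_decode (a xs)))"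
    by (rule computable_foldl[OF _ assms(2,1)])
      (intro computable_list_cons computable_nth; simp)
  moreover have "foldl (\<lambda>c x. list_encode (x # list_decode c)) m xs = list_encode (rev xs @ list_decode m)"
    for m xs using foldl_Cons_conv[of "list_decode m"] by simp
  ultimately show ?thesis by simp
qed

lemma computable_append:
  assumes "computable k a" "computable k b"
  shows "computable k (\<lambda>xs. list_encode (list_decode (a xs) @ list_decode (b xs)))"
  \<comment> \<open>Pushing letters one by one reverses a list, so two reversals are composed; 0
    codes the empty list.\<close>
  using computable_rev_append[OF computable_rev_append[OF assms(1) computable_const[of _ 0]] assms(2)]
  by simp

text \<open>Finitely many nested case distinctions. In this way the transition tables of the first
  monoid become available to an algorithm, whatever formulas define them.\<close>

lemma computable_table: "\<exists>h. computable 1 (\<lambda>xs. h (xs ! 0)) \<and> (\<forall>i < n. h i = (g :: nat \<Rightarrow> nat) i)"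
proof (induction n)
  case 0
  show ?case using computable_const[of 1 0] by fastforce
next
  case (Suc n)
  then obtain h where h: "computable 1 (\<lambda>xs. h (xs ! 0))" "\<forall>i < n. h i = g i" by blast
  have "computable 1 (\<lambda>xs. if xs ! 0 = n then g n else h (xs ! 0))"
    by (intro computable_if_eq computable_const computable_nth h(1)) auto
  then show ?case
    using h(2) by (intro exI[of _ "\<lambda>i. if i = n then g n else h i"]) auto
qed

lemma computable_table2:
  "\<exists>h. computable 2 (\<lambda>xs. h (xs ! 0) (xs ! 1)) \<and>
     (\<forall>i < m. \<forall>j < n. h i j = (g :: nat \<Rightarrow> nat \<Rightarrow> nat) i j)"
proof -
  obtain h where h: "computable 1 (\<lambda>xs. h (xs ! 0))"
    "\<forall>i < Suc (Max (prod_encode ` ({..<m} \<times> {..<n}))). h i = g (pfst i) (psnd i)"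
    using computable_table[of _ "\<lambda>c. g (pfst c) (psnd c)"] by metis
  have "h (prod_encode (i, j)) = g i j" if "i < m" "j < n" for i j
    using h(2) that Max_ge[of "prod_encode ` ({..<m} \<times> {..<n})" "prod_encode (i, j)"]
    by (simp add: less_Suc_eq_le)
  moreover have "computable 2 (\<lambda>xs. h (prod_encode (xs ! 0, xs ! 1)))"
    by (intro computable_comp1[OF h(1)] computable_prod_encode computable_nth) auto
  ultimately show ?thesis by (intro exI[of _ "\<lambda>i j. h (prod_encode (i, j))"]) simp
qed

text \<open>Both decision procedures compute an invariant of each word separately and compare: a
  normal form for the word problem, a number of letters for conjugacy.\<close>

lemma decidable_on_wordsI:
  assumes "computable 1 (\<lambda>xs. g (xs ! 0))"
    and "\<And>u v. u \<in> lists \<Sigma> \<Longrightarrow> v \<in> lists \<Sigma> \<Longrightarrow> P u v \<longleftrightarrow> g (list_encode u) = g (list_encode v)"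
  shows "decidable_on_words \<Sigma> P"
proof -
  have "computable 2 (\<lambda>xs. if g (xs ! 0) = g (xs ! 1) then 1 else 0)"
    by (intro computable_if_eq computable_const computable_comp1[OF assms(1)] computable_nth) auto
  then obtain f where f: "\<And>xs. length xs = 2 \<Longrightarrow>
      rec_eval f xs (if g (xs ! 0) = g (xs ! 1) then 1 else 0)"
    unfolding computable_def by blast
  show ?thesis
    unfolding decidable_on_words_def
    using assms(2) f[of "[list_encode _, list_encode _]"] by (intro exI[of _ f]) simp
qed

text \<open>No universal machine is needed: the program that maps \<open>n\<close> to the alleged answer for the word
  \<open>c x\<^sup>n w\<close>, where \<open>w\<close> is the word with code \<open>n\<close>, is applied to the code of the word simulating it.\<close>

lemma not_decidable_on_words:
  assumes c: "set c \<subseteq> \<Sigma>" "x \<in> \<Sigma>" "v \<in> lists \<Sigma>"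
    and sim: "\<And>f. \<exists>w \<in> lists \<Sigma>. \<forall>n z. rec_eval f [n] z \<longrightarrow>
        (P (c @ replicate n x @ w) v \<longleftrightarrow> z = 0)"
  shows "\<not> decidable_on_words \<Sigma> P"
proof
  assume "decidable_on_words \<Sigma> P"
  then obtain D where D: "\<And>u v. u \<in> lists \<Sigma> \<Longrightarrow> v \<in> lists \<Sigma> \<Longrightarrow>
      rec_eval D [list_encode u, list_encode v] (if P u v then 1 else 0)"
    unfolding decidable_on_words_def by blast
  \<comment> \<open>The input serves twice, as the exponent of \<open>x\<close> and as the code of
    the word behind it; the iteration puts \<open>x\<close> in front of the coded list.\<close>
  have "computable 1 (\<lambda>xs. list_encode (list_decode (list_encode c) @ list_decode
      (((\<lambda>l. list_encode (x # list_decode l)) ^^ (xs ! 0)) (xs ! 0))))"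
    by (intro computable_append computable_const computable_funpow computable_list_cons
        computable_nth) auto
  moreover have "((\<lambda>l. list_encode (x # list_decode l)) ^^ k) (list_encode w) =
      list_encode (replicate k x @ w)" for k w
    by (induction k) (simp_all del: list_encode.simps)
  from this[of _ "list_decode _"]
  have "((\<lambda>l. list_encode (x # list_decode l)) ^^ k) m =
      list_encode (replicate k x @ list_decode m)" for k m
    by (simp del: list_encode.simps)
  ultimately have "computable 1 (\<lambda>xs. list_encode (c @ replicate (xs ! 0) x @ list_decode (xs ! 0)))"
    by (simp del: list_encode.simps)
  then obtain f where f: "\<And>n. rec_eval f [n] (list_encode (c @ replicate n x @ list_decode n))"
    unfolding computable_def by (metis One_nat_def length_Cons list.size(3) nth_Cons_0)
  obtain f' where f': "\<And>n. rec_eval f' [n] (list_encode v)"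
    using computable_const[of 1] unfolding computable_def
    by (metis One_nat_def length_Cons list.size(3))
  obtain w where w: "w \<in> lists \<Sigma>" "\<And>n z. rec_eval (Comp D [f, f']) [n] z \<Longrightarrow>
      P (c @ replicate n x @ w) v \<longleftrightarrow> z = 0"
    using sim[of "Comp D [f, f']"] by blast
  let ?n = "list_encode w"
  let ?u = "c @ replicate ?n x @ w"
  have "?u \<in> lists \<Sigma>" using c w(1) by auto
  from D[OF this c(3)] have "rec_eval (Comp D [f, f']) [?n] (if P ?u v then 1 else 0)"
    using f[of ?n] f'[of ?n] by (auto intro!: rec_eval_Comp)
  \<comment> \<open>The answer YES is the value 1, which by the choice of \<open>w\<close> means
    that \<open>P\<close> fails; the answer NO is the value 0, which means that \<open>P\<close>
    holds.\<close>
  from w(2)[OF this] show False by (simp split: if_splits)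
qed

section \<open>String rewriting without overlaps\<close>

locale pair_rewriting =
  fixes rl :: "'a \<Rightarrow> 'a \<Rightarrow> 'a list option" and First :: "'a set"
  assumes First: "rl p q = Some r \<Longrightarrow> p \<in> First \<and> q \<notin> First"
begin

inductive rstep :: "'a list \<Rightarrow> 'a list \<Rightarrow> bool" where
  rstepI: "rl p q = Some r \<Longrightarrow> rstep (x @ p # q # y) (x @ r @ y)"

abbreviation rsteps (infix "\<leadsto>" 50) where "x \<leadsto> y \<equiv> rstep\<^sup>*\<^sup>* x y"

definition normal :: "'a list \<Rightarrow> bool" where "normal x \<longleftrightarrow> (\<nexists>y. rstep x y)"

lemma rstep_context: "rstep u v \<Longrightarrow> rstep (x @ u @ y) (x @ v @ y)"
  by (induction rule: rstep.induct) (metis append.assoc append_Cons rstepI)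

lemma rsteps_context: "u \<leadsto> v \<Longrightarrow> x @ u @ y \<leadsto> x @ v @ y"
  by (induction rule: rtranclp_induct) (auto intro: rstep_context rtranclp.rtrancl_into_rtrancl)

lemma rsteps_context_left: "u \<leadsto> v \<Longrightarrow> x @ u \<leadsto> x @ v"
  using rsteps_context[of u v x "[]"] by simp

lemma rsteps_context_right: "u \<leadsto> v \<Longrightarrow> u @ y \<leadsto> v @ y"
  using rsteps_context[of u v "[]" y] by simp

lemma rsteps_Cons: "u \<leadsto> v \<Longrightarrow> a # u \<leadsto> a # v"
  using rsteps_context_left[of u v "[a]"] by simp

lemma rsteps_rule: "rl p q = Some r \<Longrightarrow> p # q # y \<leadsto> r @ y"
  using rstepI[of p q r "[]" y] by auto

lemma normal_iff: "normal w \<longleftrightarrow> (\<forall>x p q y. w = x @ p # q # y \<longrightarrow> rl p q = None)"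
proof
  assume "normal w"
  then show "\<forall>x p q y. w = x @ p # q # y \<longrightarrow> rl p q = None"
    unfolding normal_def using rstepI by (metis option.exhaust)
next
  assume *: "\<forall>x p q y. w = x @ p # q # y \<longrightarrow> rl p q = None"
  have False if "rstep w v" for v
    using that by cases (use * in auto)
  then show "normal w" unfolding normal_def by blast
qed

text \<open>Redexes cannot overlap, as the second letter of a redex is never the first letter of one.\<close>

lemma diamond_aux:
  assumes "x @ p # q # y = x' @ p' # q' # y'" "length x \<le> length x'"
    and r: "rl p q = Some r" "rl p' q' = Some r'"
  shows "x @ r @ y = x' @ r' @ y' \<or> (\<exists>c. rstep (x @ r @ y) c \<and> rstep (x' @ r' @ y') c)"
proof -
  obtain us where us: "x' = x @ us" "p # q # y = us @ p' # q' # y'"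
    using assms(1,2) by (auto simp: append_eq_append_conv2)
  consider "us = []" | "us = [p]" | vs where "us = p # q # vs"
    using us(2) by (auto simp: Cons_eq_append_conv)
  then show ?thesis
  proof cases
    case 1
    then show ?thesis using us r by auto
  next
    case 2
    then show ?thesis using us r First[of p q r] First[of p' q' r'] by auto
  next
    case 3
    then have "y = vs @ p' # q' # y'" using us(2) by simp
    then have "rstep (x @ r @ y) (x @ r @ vs @ r' @ y')"
      using rstepI[OF r(2), of "x @ r @ vs" y'] by simp
    moreover have "rstep (x' @ r' @ y') (x @ r @ vs @ r' @ y')"
      using rstepI[OF r(1), of x "vs @ r' @ y'"] us(1) 3 by simp
    ultimately show ?thesis by blast
  qed
qed

lemma diamond:
  assumes "rstep w a" "rstep w b"
  shows "a = b \<or> (\<exists>c. rstep a c \<and> rstep b c)"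
proof -
  obtain x p q y r where w: "w = x @ p # q # y" "a = x @ r @ y" "rl p q = Some r"
    using assms(1) by cases auto
  obtain x' p' q' y' r' where w': "w = x' @ p' # q' # y'" "b = x' @ r' @ y'" "rl p' q' = Some r'"
    using assms(2) by cases auto
  show ?thesis
  proof (cases "length x \<le> length x'")
    case True
    then show ?thesis using diamond_aux[of x p q y x' p' q' y' r r'] w w' by auto
  next
    case False
    then show ?thesis using diamond_aux[of x' p' q' y' x p q y r' r] w w' by auto
  qed
qed

text \<open>Two different first steps are joined by one further step each, so by induction any first
  step uses up exactly one of the \<open>n\<close> steps. This yields a measure that decreases under
  every strategy.\<close>

lemma random_descent:
  assumes "(rstep ^^ n) x z" "normal z" "rstep x y"
  shows "\<exists>k. n = Suc k \<and> (rstep ^^ k) y z"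
  using assms
proof (induction n arbitrary: x y)
  case 0
  then show ?case by (simp add: normal_def)
next
  case (Suc n)
  obtain x' where x': "rstep x x'" "(rstep ^^ n) x' z"
    using Suc.prems(1) by (metis relpowp_Suc_D2)
  show ?case
  proof (cases "x' = y")
    case False
    then obtain c where c: "rstep x' c" "rstep y c"
      using diamond[OF x'(1) Suc.prems(3)] by blast
    then obtain k where "n = Suc k" "(rstep ^^ k) c z"
      using Suc.IH[OF x'(2) Suc.prems(2)] by blast
    then show ?thesis using c(2) by (metis relpowp_Suc_I2)
  qed (use x' in blast)
qed

lemma random_descent_steps:
  assumes "(rstep ^^ n) x z" "normal z" "x \<leadsto> y"
  shows "\<exists>k \<le> n. (rstep ^^ k) y z \<and> (y \<noteq> x \<longrightarrow> k < n)"
  using assms(3)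
proof (induction rule: rtranclp_induct)
  case base
  then show ?case using assms(1) by blast
next
  case (step y y')
  then obtain k where k: "k \<le> n" "(rstep ^^ k) y z" by blast
  then obtain k' where "k = Suc k'" "(rstep ^^ k') y' z"
    using random_descent[OF _ assms(2) step(2)] by blast
  then show ?case using k(1) by (intro exI[of _ k']) auto
qed

definition conv :: "'a list \<Rightarrow> 'a list \<Rightarrow> bool" where
  "conv = (\<lambda>x y. rstep x y \<or> rstep y x)\<^sup>*\<^sup>*"

lemma conv_sym: "conv x y \<Longrightarrow> conv y x"
  unfolding conv_def by (rule sympD[OF symp_rtranclp]) (auto intro: sympI)

lemma conv_trans: "conv x y \<Longrightarrow> conv y z \<Longrightarrow> conv x z"
  unfolding conv_def by (rule rtranclp_trans)

lemma rstep_conv: "rstep x y \<Longrightarrow> conv x y"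
  unfolding conv_def by auto

text \<open>Induction from the end \<open>y\<close>: a forward step is prepended to the reduction
  found so far, and after a backward step random descent finds a reduction of the new word.\<close>

lemma conv_normal:
  assumes "conv x y" "normal y"
  shows "x \<leadsto> y"
  using assms(1) unfolding conv_def
proof (induction rule: converse_rtranclp_induct)
  case (step x x')
  from step(1) show ?case
  proof
    assume "rstep x' x"
    moreover obtain n where "(rstep ^^ n) x' y"
      using step.IH by (metis rtranclp_power)
    ultimately obtain k where "(rstep ^^ k) x y"
      using random_descent[OF _ assms(2)] by blast
    then show ?thesis by (metis rtranclp_power)
  qed (use step.IH in \<open>metis converse_rtranclp_into_rtranclp\<close>)
qed simp

lemma normal_unique:
  assumes "x \<leadsto> y" "x \<leadsto> z" "normal y" "normal z"
  shows "y = z"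
proof -
  obtain n where "(rstep ^^ n) x y" using assms(1) by (metis rtranclp_power)
  then obtain k where "(rstep ^^ k) z y"
    using random_descent_steps[OF _ assms(3,2)] by blast
  then show ?thesis
    using assms(4) by (cases k) (auto simp: normal_def dest!: relpowp_Suc_D2 simp del: relpowp.simps(2))
qed

lemma rsteps_bubble:
  assumes "\<And>a b. a \<in> set as \<Longrightarrow> b \<in> set bs \<Longrightarrow> rl a b = Some [b, a]"
  shows "as @ bs \<leadsto> bs @ as"
  using assms
proof (induction bs)
  case (Cons b bs)
  have "as @ [b] \<leadsto> b # as"
    using Cons.prems
  proof (induction as)
    case (Cons a as)
    then have "a # as @ [b] \<leadsto> a # b # as"
      by (intro rsteps_Cons) auto
    also have "a # b # as \<leadsto> b # a # as"
      using rsteps_rule[of a b "[b, a]" as] Cons.prems by simp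
    finally show ?case by simp
  qed simp
  from rsteps_context_right[OF this, of bs] have "as @ b # bs \<leadsto> b # as @ bs" by simp
  also have "b # as @ bs \<leadsto> b # bs @ as"
    using Cons by (intro rsteps_Cons) auto
  finally show ?case by simp
qed simp

end

section \<open>A rewriting system interpreting loop programs\<close>

text \<open>A configuration is \<open>#\<close> followed by a queue of unary registers, each written as a comma and
  ones, followed by a program. The last register is the front of the queue. Program letters: \<open>ROT SEP\<close>
  moves the front register to the back, \<open>INC\<close> and \<open>DEC\<close> act on the front register,
  \<open>OPN \<dots> CLS\<close> is a loop running while the front register is nonzero. The letters of a loop body at
  depth \<open>k\<close> are prefixed by \<open>ESC\<^sup>k\<close>, so that a block ends at the first unescaped \<open>CLS\<close>. A loop is
  unrolled by the copiers \<open>COPY\<close> and \<open>COPY1\<close>, which mark the letters they have passed and send a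
  \<open>flying\<close> copy of them, with one \<open>ESC\<close> removed, to the left up to \<open>LB\<close>; \<open>BACK\<close> then removes the
  marks. \<open>HALT\<close> deletes registers that are zero. The letter 0 is not used by the rules.\<close>

abbreviation ROT :: nat where "ROT \<equiv> 2"
abbreviation SEP :: nat where "SEP \<equiv> 3"
abbreviation INC :: nat where "INC \<equiv> 4"
abbreviation DEC :: nat where "DEC \<equiv> 5"
abbreviation OPN :: nat where "OPN \<equiv> 6"
abbreviation CLS :: nat where "CLS \<equiv> 7"
abbreviation ESC :: nat where "ESC \<equiv> 8"
abbreviation HALT :: nat where "HALT \<equiv> 9"
abbreviation MCOMMA :: nat where "MCOMMA \<equiv> 10"
abbreviation MONE :: nat where "MONE \<equiv> 11"
abbreviation BACK :: nat where "BACK \<equiv> 19"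
abbreviation flying :: "nat \<Rightarrow> nat" where "flying x \<equiv> x + 10"
abbreviation HASH :: nat where "HASH \<equiv> 20"
abbreviation COMMA :: nat where "COMMA \<equiv> 21"
abbreviation ONE :: nat where "ONE \<equiv> 22"
abbreviation SEMI :: nat where "SEMI \<equiv> 23"
abbreviation LB :: nat where "LB \<equiv> 24"
abbreviation COPY :: nat where "COPY \<equiv> 25"
abbreviation COPY1 :: nat where "COPY1 \<equiv> 26"
abbreviation ERASE :: nat where "ERASE \<equiv> 27"
abbreviation ERASE1 :: nat where "ERASE1 \<equiv> 28"
abbreviation marked :: "nat \<Rightarrow> nat" where "marked x \<equiv> x + 27"

definition rule :: "nat \<Rightarrow> nat \<Rightarrow> nat list option" where
  "rule p q =
    (if p = ONE then
       (if q = ROT then Some [ROT, MONE]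
        else if q = SEP \<or> q = MCOMMA \<or> q = MONE then Some [q, ONE]
        else if q = INC then Some [ONE, ONE]
        else if q = DEC then Some []
        else if q = OPN then Some [ONE, LB, COPY]
        else None)
     else if p = COMMA then
       (if q = ROT then Some [MCOMMA]
        else if q = SEP \<or> q = MCOMMA \<or> q = MONE then Some [q, COMMA]
        else if q = INC then Some [COMMA, ONE]
        else if q = OPN then Some [COMMA, ERASE]
        else if q = HALT then Some [HALT]
        else None)
     else if p = HASH then (if q = MCOMMA then Some [HASH, COMMA, SEMI] else None)
     else if p = SEMI then
       (if q = MONE then Some [ONE, SEMI] else if q = SEP then Some [] else None)
     else if p = LB then
       (if flying ROT \<le> q \<and> q \<le> flying ESC then Some [q - 10, LB]
        else if q = BACK then Some [OPN] else None)
     else if p = COPY then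
       (if q = ESC then Some [marked ESC, COPY1] else if q = CLS then Some [BACK, CLS] else None)
     else if p = COPY1 then
       (if q = ESC then Some [flying ESC, marked ESC, COPY1]
        else if ROT \<le> q \<and> q \<le> CLS then Some [flying q, marked q, COPY] else None)
     else if p = ERASE then
       (if q = ESC then Some [ERASE1] else if q = CLS then Some [] else None)
     else if p = ERASE1 then
       (if q = ESC then Some [ERASE1] else if ROT \<le> q \<and> q \<le> CLS then Some [ERASE] else None)
     else if marked ROT \<le> p \<and> p \<le> marked ESC then
       (if flying ROT \<le> q \<and> q \<le> flying ESC then Some [q, p]
        else if q = BACK then Some [BACK, p - 27] else None)
     else None)"

lemma rule_simps [simp]:
  "rule ONE ROT = Some [ROT, MONE]" "rule COMMA ROT = Some [MCOMMA]"
  "rule ONE SEP = Some [SEP, ONE]" "rule ONE MCOMMA = Some [MCOMMA, ONE]" "rule ONE MONE = Some [MONE, ONE]"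
  "rule COMMA SEP = Some [SEP, COMMA]" "rule COMMA MCOMMA = Some [MCOMMA, COMMA]"
  "rule COMMA MONE = Some [MONE, COMMA]" "rule HASH MCOMMA = Some [HASH, COMMA, SEMI]"
  "rule SEMI MONE = Some [ONE, SEMI]" "rule SEMI SEP = Some []"
  "rule ONE INC = Some [ONE, ONE]" "rule COMMA INC = Some [COMMA, ONE]" "rule ONE DEC = Some []"
  "rule ONE OPN = Some [ONE, LB, COPY]" "rule COMMA OPN = Some [COMMA, ERASE]"
  "rule COMMA HALT = Some [HALT]" "rule ONE HALT = None" "rule HASH HALT = None"
  "rule COPY ESC = Some [marked ESC, COPY1]" "rule COPY CLS = Some [BACK, CLS]"
  "rule COPY1 ESC = Some [flying ESC, marked ESC, COPY1]" "rule LB BACK = Some [OPN]"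
  "rule ERASE ESC = Some [ERASE1]" "rule ERASE CLS = Some []" "rule ERASE1 ESC = Some [ERASE1]"
  by (simp_all add: rule_def)

lemma rule_letters [simp]:
  "\<lbrakk>ROT \<le> x; x \<le> CLS\<rbrakk> \<Longrightarrow> rule COPY1 x = Some [flying x, marked x, COPY]"
  "\<lbrakk>ROT \<le> x; x \<le> CLS\<rbrakk> \<Longrightarrow> rule ERASE1 x = Some [ERASE]"
  "\<lbrakk>ROT \<le> x; x \<le> ESC\<rbrakk> \<Longrightarrow> rule LB (flying x) = Some [x, LB]"
  "\<lbrakk>ROT \<le> x; x \<le> ESC\<rbrakk> \<Longrightarrow> rule (marked x) BACK = Some [BACK, x]"
  "\<lbrakk>marked ROT \<le> p; p \<le> marked ESC; ROT \<le> x; x \<le> ESC\<rbrakk> \<Longrightarrow> rule p (flying x) = Some [flying x, p]"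
  by (auto simp: rule_def)

lemma rule_SomeD:
  "rule p q = Some r \<Longrightarrow> 20 \<le> p \<and> p < 36 \<and> 0 < q \<and> q < 20 \<and> set r \<subseteq> {1..<36}"
  by (auto simp: rule_def split: if_splits)

text \<open>The numbering serves this interpretation: a letter below 20 can only be second in a
  redex, one from 20 on only first. Adding 10 keeps a program letter among the former, adding 27
  moves it to the latter.\<close>

interpretation pair_rewriting rule "{20..}"
  by unfold_locales (auto dest: rule_SomeD)

abbreviation reduces (infix "\<leadsto>" 50) where "x \<leadsto> y \<equiv> rstep\<^sup>*\<^sup>* x y"

lemma reduces_trans [trans]: "x \<leadsto> y \<Longrightarrow> y \<leadsto> z \<Longrightarrow> x \<leadsto> z"
  by (rule rtranclp_trans)

section \<open>Words for configurations and programs, and the moves of the interpreter\<close>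

primrec registers :: "nat list \<Rightarrow> nat list" where
  "registers [] = []"
| "registers (x # L) = registers L @ COMMA # replicate x ONE"

definition config :: "nat list \<Rightarrow> nat list" where "config L = HASH # registers L"

definition prog_word :: "(nat \<times> nat) list \<Rightarrow> nat list" where
  "prog_word ts = concat (map (\<lambda>(k, x). replicate k ESC @ [x]) ts)"

definition escape :: "(nat \<times> nat) list \<Rightarrow> (nat \<times> nat) list" where
  "escape ts = map (\<lambda>(k, x). (Suc k, x)) ts"

definition rotation :: "nat \<Rightarrow> (nat \<times> nat) list" where
  "rotation j = concat (replicate j [(0, ROT), (0, SEP)])"

lemma registers_append: "registers (L @ L') = registers L' @ registers L"
  by (induction L) auto

lemma set_registers: "set (registers L) \<subseteq> {COMMA, ONE}"
  by (induction L) auto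

lemma prog_word_simps [simp]:
  "prog_word [] = []" "prog_word ((k, x) # ts) = replicate k ESC @ x # prog_word ts" "prog_word (ts @ ts') = prog_word ts @ prog_word ts'"
  by (auto simp: prog_word_def)

lemma escape_simps [simp]:
  "escape [] = []" "escape ((k, x) # ts) = (Suc k, x) # escape ts" "escape (ts @ ts') = escape ts @ escape ts'"
  by (auto simp: escape_def)

lemma rotation_simps [simp]: "rotation 0 = []" "rotation (Suc j) = (0, ROT) # (0, SEP) # rotation j"
  by (simp_all add: rotation_def)

lemma replicate_pull: "replicate n x @ x # ys = x # replicate n x @ ys"
  by (induction n) auto

text \<open>\<open>ROT\<close> turns the front register into the mobile letters
  \<open>MCOMMA\<close> and \<open>MONE\<close>, which travel left through the other registers,
  followed by \<open>SEP\<close>. At \<open>HASH\<close> the comma is restored together with a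
  \<open>SEMI\<close>, which turns each \<open>MONE\<close> back into \<open>ONE\<close> until it
  meets \<open>SEP\<close> and both vanish.\<close>

lemma sim_rot: "config (x # L) @ [ROT, SEP] \<leadsto> config (L @ [x])"
proof -
  have 1: "replicate n ONE @ [ROT] \<leadsto> ROT # replicate n MONE" for n
  proof (induction n)
    case (Suc n)
    have "ONE # replicate n ONE @ [ROT] \<leadsto> ONE # ROT # replicate n MONE"
      using Suc by (rule rsteps_Cons)
    also have "\<dots> \<leadsto> [ROT, MONE] @ replicate n MONE"
      by (rule rsteps_rule) simp
    finally show ?case by simp
  qed simp
  have "COMMA # replicate x ONE @ [ROT] \<leadsto> COMMA # ROT # replicate x MONE"
    using 1 by (rule rsteps_Cons)
  also have "\<dots> \<leadsto> [MCOMMA] @ replicate x MONE"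
    by (rule rsteps_rule) simp
  finally have "COMMA # replicate x ONE @ [ROT] \<leadsto> MCOMMA # replicate x MONE" by simp
  from rsteps_context[OF this, of "HASH # registers L" "[SEP]"]
  have "config (x # L) @ [ROT, SEP] \<leadsto> HASH # registers L @ (MCOMMA # replicate x MONE @ [SEP])"
    by (simp add: config_def)
  also have "\<dots> \<leadsto> HASH # (MCOMMA # replicate x MONE @ [SEP]) @ registers L"
    by (intro rsteps_Cons rsteps_bubble) (use set_registers[of L] in \<open>auto\<close>)
  also have "\<dots> \<leadsto> [HASH, COMMA, SEMI] @ (replicate x MONE @ [SEP]) @ registers L"
    using rsteps_rule[of HASH MCOMMA "[HASH, COMMA, SEMI]"] by simp
  also have "\<dots> \<leadsto> [HASH, COMMA] @ (replicate x ONE @ [SEMI]) @ SEP # registers L"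
  proof -
    have "SEMI # replicate x MONE \<leadsto> replicate x ONE @ [SEMI]"
    proof (induction x)
      case (Suc n)
      have "SEMI # MONE # replicate n MONE \<leadsto> [ONE, SEMI] @ replicate n MONE"
        by (rule rsteps_rule) simp
      also have "\<dots> \<leadsto> ONE # replicate n ONE @ [SEMI]"
        using Suc by (simp add: rsteps_Cons)
      finally show ?case by simp
    qed simp
    from rsteps_context[OF this, of "[HASH, COMMA]" "SEP # registers L"] show ?thesis by simp
  qed
  also have "\<dots> \<leadsto> ([HASH, COMMA] @ replicate x ONE) @ [] @ registers L"
    using rsteps_context_left[OF rsteps_rule[of SEMI SEP "[]" "registers L"],
        of "[HASH, COMMA] @ replicate x ONE"]
    by simp
  finally show ?thesis by (simp add: config_def registers_append)
qed

lemma sim_rotation: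
  assumes "L \<noteq> []"
  shows "config L @ prog_word (rotation j) \<leadsto> config (rotate j L)"
  using assms
proof (induction j arbitrary: L)
  case (Suc j)
  then obtain x L' where L: "L = x # L'" by (cases L) auto
  from rsteps_context_right[OF sim_rot[of x L'], of "prog_word (rotation j)"]
  have "config L @ prog_word (rotation (Suc j)) \<leadsto> config (L' @ [x]) @ prog_word (rotation j)"
    by (simp add: L)
  also have "\<dots> \<leadsto> config (rotate j (L' @ [x]))" by (rule Suc.IH) simp
  finally show ?case by (simp add: L rotate1_rotate_swap)
qed simp

definition program :: "(nat \<times> nat) list \<Rightarrow> bool" where
  "program ts \<longleftrightarrow> snd ` set ts \<subseteq> {ROT..CLS}"

lemma program_simps [simp]:
  "program []" "program ((k, x) # ts) \<longleftrightarrow> ROT \<le> x \<and> x \<le> CLS \<and> program ts"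
  "program (ts @ ts') \<longleftrightarrow> program ts \<and> program ts'" "program (escape ts) \<longleftrightarrow> program ts"
  by (force simp: program_def escape_def)+

lemma program_rotation [simp]: "program (rotation j)"
  by (induction j) auto

lemma sim_emit:
  assumes "set P \<subseteq> {marked ROT..marked ESC}" "ROT \<le> x" "x \<le> ESC"
  shows "LB # P @ flying x # ys \<leadsto> x # LB # P @ ys"
proof -
  have "P @ [flying x] \<leadsto> [flying x] @ P"
    by (rule rsteps_bubble) (use assms in \<open>auto\<close>)
  from rsteps_context[OF this, of "[LB]" ys] have "LB # P @ flying x # ys \<leadsto> LB # flying x # P @ ys"
    by simp
  also have "\<dots> \<leadsto> [x, LB] @ P @ ys"
    by (rule rsteps_rule) (use assms in \<open>auto\<close>)
  finally show ?thesis by simp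
qed

text \<open>\<open>COPY\<close> has already marked one \<open>ESC\<close> without copying it, which
  lowers the depth of the copy by one; \<open>COPY1\<close> copies the rest of the token. Each
  copied letter is sent off to the left before the next one is made, so their order is kept.\<close>

lemma sim_copy_token:
  assumes "set P \<subseteq> {marked ROT..marked ESC}" "ROT \<le> x" "x \<le> CLS"
  shows "LB # P @ COPY1 # replicate k ESC @ x # ys \<leadsto>
    replicate k ESC @ x # LB # P @ replicate k (marked ESC) @ marked x # COPY # ys"
  using assms(1)
proof (induction k arbitrary: P)
  case 0
  have "LB # P @ COPY1 # x # ys \<leadsto> LB # P @ [flying x, marked x, COPY] @ ys"
    using rsteps_context_left[OF rsteps_rule[of COPY1 x "[flying x, marked x, COPY]" ys], of "LB # P"] assms
    by simp
  also have "\<dots> \<leadsto> x # LB # P @ [marked x, COPY] @ ys"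
    using sim_emit[OF 0, of x "[marked x, COPY] @ ys"] assms by simp
  finally show ?case by simp
next
  case (Suc k)
  let ?zs = "replicate k ESC @ x # ys"
  have "LB # P @ COPY1 # ESC # ?zs \<leadsto> LB # P @ [flying ESC, marked ESC, COPY1] @ ?zs"
    using rsteps_context_left[OF rsteps_rule[of COPY1 ESC "[flying ESC, marked ESC, COPY1]" ?zs], of "LB # P"]
    by simp
  also have "\<dots> \<leadsto> ESC # LB # P @ [marked ESC, COPY1] @ ?zs"
    using sim_emit[OF Suc.prems, of ESC "[marked ESC, COPY1] @ ?zs"] by simp
  also have "\<dots> \<leadsto> ESC # replicate k ESC @ x # LB # (P @ [marked ESC]) @
      replicate k (marked ESC) @ marked x # COPY # ys"
    using rsteps_Cons[OF Suc.IH[of "P @ [marked ESC]"], of ESC] Suc.prems by simp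
  finally show ?case by simp
qed

lemma sim_copy:
  assumes "set P \<subseteq> {marked ROT..marked ESC}" "program ts"
  shows "LB # P @ COPY # prog_word (escape ts) @ ys \<leadsto>
    prog_word ts @ LB # P @ map marked (prog_word (escape ts)) @ COPY # ys"
  using assms
proof (induction ts arbitrary: P)
  case (Cons t ts)
  obtain k x where t: "t = (k, x)" by (cases t)
  let ?zs = "replicate k ESC @ x # prog_word (escape ts) @ ys"
  let ?P = "P @ marked ESC # replicate k (marked ESC) @ [marked x]"
  have P: "set ?P \<subseteq> {marked ROT..marked ESC}"
    using Cons.prems t by (auto split: if_splits)
  have "LB # P @ COPY # ESC # ?zs \<leadsto> LB # P @ [marked ESC, COPY1] @ ?zs"
    using rsteps_context_left[OF rsteps_rule[of COPY ESC "[marked ESC, COPY1]" ?zs], of "LB # P"]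
    by simp
  also have "\<dots> \<leadsto> replicate k ESC @ x # LB # ?P @ COPY # prog_word (escape ts) @ ys"
    using sim_copy_token[of "P @ [marked ESC]" x k "prog_word (escape ts) @ ys"] Cons.prems t by simp
  also have "\<dots> \<leadsto> replicate k ESC @ x # prog_word ts @ LB # ?P @ map marked (prog_word (escape ts)) @ COPY # ys"
    using rsteps_context_left[OF Cons.IH[OF P], of "replicate k ESC @ [x]"] Cons.prems t by simp
  finally show ?case by (simp add: t)
qed simp

lemma sim_loop_enter:
  assumes "program ts"
  shows "ONE # OPN # prog_word (escape ts) @ [CLS] \<leadsto> ONE # prog_word ts @ OPN # prog_word (escape ts) @ [CLS]"
proof -
  let ?W = "prog_word (escape ts)"
  have W: "set ?W \<subseteq> {ROT..ESC}"
  proof -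
    have "set (replicate k ESC) \<subseteq> {ROT..ESC}" for k by (cases k) auto
    then show ?thesis using assms by (induction ts) (auto simp del: set_replicate dest!: subsetD)
  qed
  have "ONE # OPN # ?W @ [CLS] \<leadsto> [ONE, LB, COPY] @ ?W @ [CLS]"
    by (rule rsteps_rule) simp
  also have "\<dots> \<leadsto> ONE # prog_word ts @ LB # map marked ?W @ [COPY, CLS]"
    using rsteps_Cons[OF sim_copy[of "[]" ts "[CLS]"]] assms by simp
  also have "\<dots> \<leadsto> ONE # prog_word ts @ LB # map marked ?W @ [BACK, CLS]"
    using rsteps_context_left[OF rsteps_rule[of COPY CLS "[BACK, CLS]" "[]"],
        of "ONE # prog_word ts @ LB # map marked ?W"]
    by simp
  also have "\<dots> \<leadsto> ONE # prog_word ts @ LB # BACK # ?W @ [CLS]"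
  proof -
    have "map marked xs @ [BACK] \<leadsto> BACK # xs" if "set xs \<subseteq> {ROT..ESC}" for xs
      using that
    proof (induction xs)
      case (Cons x xs)
      then have "marked x # map marked xs @ [BACK] \<leadsto> marked x # BACK # xs"
        by (intro rsteps_Cons) auto
      also have "\<dots> \<leadsto> [BACK, x] @ xs"
        by (rule rsteps_rule) (use Cons.prems in \<open>auto\<close>)
      finally show ?case by simp
    qed simp
    from rsteps_context[OF this[OF W], of "ONE # prog_word ts @ [LB]" "[CLS]"] show ?thesis by simp
  qed
  also have "\<dots> \<leadsto> ONE # prog_word ts @ OPN # ?W @ [CLS]"
    using rsteps_context_left[OF rsteps_rule[of LB BACK "[OPN]" "?W @ [CLS]"], of "ONE # prog_word ts"]
    by simp
  finally show ?thesis .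
qed

text \<open>\<open>ERASE\<close> and \<open>ERASE1\<close> parse the block as \<open>COPY\<close>
  and \<open>COPY1\<close> do, so an escaped \<open>CLS\<close> is deleted as part of the body and
  only the unescaped one ends the deletion.\<close>

lemma sim_loop_exit:
  assumes "program ts"
  shows "COMMA # OPN # prog_word (escape ts) @ [CLS] \<leadsto> [COMMA]"
proof -
  have erase: "ERASE1 # replicate k ESC @ x # ys \<leadsto> ERASE # ys" if "ROT \<le> x" "x \<le> CLS" for k x ys
  proof (induction k)
    case 0
    then show ?case using rsteps_rule[of ERASE1 x "[ERASE]" ys] that by simp
  next
    case (Suc k)
    have "ERASE1 # ESC # replicate k ESC @ x # ys \<leadsto> [ERASE1] @ replicate k ESC @ x # ys"
      by (rule rsteps_rule) simp
    then show ?case using Suc by simp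
  qed
  have "ERASE # prog_word (escape ts) @ [CLS] \<leadsto> []"
    using assms
  proof (induction ts)
    case Nil
    then show ?case using rsteps_rule[of ERASE CLS "[]" "[]"] by simp
  next
    case (Cons t ts)
    obtain k x where t: "t = (k, x)" by (cases t)
    have "ERASE # ESC # replicate k ESC @ x # prog_word (escape ts) @ [CLS] \<leadsto>
        [ERASE1] @ replicate k ESC @ x # prog_word (escape ts) @ [CLS]"
      by (rule rsteps_rule) simp
    also have "\<dots> \<leadsto> ERASE # prog_word (escape ts) @ [CLS]"
      using erase Cons.prems t by simp
    also have "\<dots> \<leadsto> []" using Cons t by simp
    finally show ?case by (simp add: t)
  qed
  from rsteps_Cons[OF this, of COMMA]
  show ?thesis
    using rsteps_rule[of COMMA OPN "[COMMA, ERASE]" "prog_word (escape ts) @ [CLS]"] by simp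
qed

section \<open>Loop programs and their translation into words\<close>

datatype com = Skip | Inc nat | Dec nat | Seq com com | Loop nat com

text \<open>\<open>Dec\<close> has no result on a zero register, just as no rule has the left-hand
  side \<open>[COMMA, DEC]\<close>; the compiled programs decrement a register only inside a loop on
  it.\<close>

inductive exec :: "com \<Rightarrow> (nat \<Rightarrow> nat) \<Rightarrow> (nat \<Rightarrow> nat) \<Rightarrow> bool" where
  exec_Skip: "exec Skip s s"
| exec_Inc: "exec (Inc r) s (s(r := Suc (s r)))"
| exec_Dec: "s r = Suc k \<Longrightarrow> exec (Dec r) s (s(r := k))"
| exec_Seq: "exec c s s' \<Longrightarrow> exec c' s' s'' \<Longrightarrow> exec (Seq c c') s s''"
| exec_Loop_end: "s r = 0 \<Longrightarrow> exec (Loop r c) s s"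
| exec_Loop: "s r \<noteq> 0 \<Longrightarrow> exec c s s' \<Longrightarrow> exec (Loop r c) s' s'' \<Longrightarrow> exec (Loop r c) s s''"

primrec regs :: "com \<Rightarrow> nat set" where
  "regs Skip = {}"
| "regs (Inc r) = {r}"
| "regs (Dec r) = {r}"
| "regs (Seq c c') = regs c \<union> regs c'"
| "regs (Loop r c) = insert r (regs c)"

lemma finite_regs: "finite (regs c)"
  by (induction c) auto

text \<open>With \<open>m\<close> registers, \<open>rotation r\<close> brings register
  \<open>r\<close> to the front and \<open>rotation (m - r)\<close> restores the order. A loop tests
  its register at the front, so its body starts by restoring the order and ends by bringing register
  \<open>r\<close> to the front again.\<close>

primrec tokens :: "nat \<Rightarrow> com \<Rightarrow> (nat \<times> nat) list" where
  "tokens m Skip = []"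
| "tokens m (Inc r) = rotation r @ (0, INC) # rotation (m - r)"
| "tokens m (Dec r) = rotation r @ (0, DEC) # rotation (m - r)"
| "tokens m (Seq c c') = tokens m c @ tokens m c'"
| "tokens m (Loop r c) = rotation r @ (0, OPN) # escape (rotation (m - r) @ tokens m c @ rotation r) @
     (0, CLS) # rotation (m - r)"

lemma program_tokens: "program (tokens m c)"
  by (induction c) auto

lemma rotate_to_front: "j < length L \<Longrightarrow> rotate j L = L ! j # drop (Suc j) L @ take j L"
  by (simp add: rotate_drop_take Cons_nth_drop_Suc)

lemma rotate_back:
  assumes "j < length L"
  shows "rotate (length L - j) (x # drop (Suc j) L @ take j L) = L[j := x]"
proof -
  have "length L - j = length (x # drop (Suc j) L)" using assms by simp
  then have "rotate (length L - j) ((x # drop (Suc j) L) @ take j L) = take j L @ x # drop (Suc j) L"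
    by (metis rotate_append)
  then show ?thesis using assms by (simp add: upd_conv_take_nth_drop)
qed

lemma map_upt_update: "(map s [0..<m])[r := x] = map (s(r := x)) [0..<m]"
  by (auto intro!: nth_equalityI simp: nth_list_update)

lemma sim_exec:
  assumes "exec c s s'" "regs c \<subseteq> {..<m}"
  shows "config (map s [0..<m]) @ prog_word (tokens m c) \<leadsto> config (map s' [0..<m])"
  using assms
proof (induction rule: exec.induct)
  case (exec_Skip s)
  then show ?case by simp
next
  case (exec_Inc r s)
  let ?L = "map s [0..<m]"
  have r: "r < length ?L" "?L \<noteq> []" using exec_Inc by auto
  let ?d = "drop (Suc r) ?L @ take r ?L"
  have "config ?L @ prog_word (tokens m (Inc r)) \<leadsto> config (s r # ?d) @ INC # prog_word (rotation (m - r))"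
    using rsteps_context_right[OF sim_rotation[of ?L r], of "INC # prog_word (rotation (m - r))"] r
      rotate_to_front[OF r(1)] by simp
  also have "\<dots> \<leadsto> config (Suc (s r) # ?d) @ prog_word (rotation (m - r))"
  proof -
    have "(COMMA # replicate k ONE) @ [INC] \<leadsto> COMMA # replicate (Suc k) ONE" for k
    proof (cases k)
      case 0
      then show ?thesis using rsteps_rule[of COMMA INC "[COMMA, ONE]" "[]"] by simp
    next
      case (Suc k')
      then show ?thesis
        using rsteps_context_left[OF rsteps_rule[of ONE INC "[ONE, ONE]" "[]"],
            of "COMMA # replicate k' ONE"]
        by (simp add: replicate_pull)
    qed
    from rsteps_context[OF this, of "HASH # registers ?d" "s r" "prog_word (rotation (m - r))"]
    show ?thesis by (simp add: config_def del: replicate_Suc)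
  qed
  also have "\<dots> \<leadsto> config (rotate (m - r) (Suc (s r) # ?d))"
    by (rule sim_rotation) simp
  also have "rotate (m - r) (Suc (s r) # ?d) = map (s(r := Suc (s r))) [0..<m]"
    using rotate_back[OF r(1), of "Suc (s r)"] r by (simp add: map_upt_update)
  finally show ?case .
next
  case (exec_Dec s r k)
  let ?L = "map s [0..<m]"
  have r: "r < length ?L" "?L \<noteq> []" using exec_Dec by auto
  let ?d = "drop (Suc r) ?L @ take r ?L"
  have "config ?L @ prog_word (tokens m (Dec r)) \<leadsto> config (s r # ?d) @ DEC # prog_word (rotation (m - r))"
    using rsteps_context_right[OF sim_rotation[of ?L r], of "DEC # prog_word (rotation (m - r))"] r
      rotate_to_front[OF r(1)] by simp
  also have "\<dots> \<leadsto> config (k # ?d) @ prog_word (rotation (m - r))"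
    using rsteps_context_left[OF rsteps_rule[of ONE DEC "[]" "prog_word (rotation (m - r))"],
        of "HASH # registers ?d @ COMMA # replicate k ONE"] exec_Dec
    by (simp add: config_def replicate_pull)
  also have "\<dots> \<leadsto> config (rotate (m - r) (k # ?d))"
    by (rule sim_rotation) simp
  also have "rotate (m - r) (k # ?d) = map (s(r := k)) [0..<m]"
    using rotate_back[OF r(1), of k] r by (simp add: map_upt_update)
  finally show ?case .
next
  case (exec_Seq c s s' c' s'')
  then show ?case
    using rsteps_context_right[of "config (map s [0..<m]) @ prog_word (tokens m c)" "config (map s' [0..<m])"
        "prog_word (tokens m c')"] by (auto intro: rtranclp_trans)
next
  case (exec_Loop_end s r c)
  let ?L = "map s [0..<m]"
  have r: "r < length ?L" "?L \<noteq> []" using exec_Loop_end by auto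
  let ?d = "drop (Suc r) ?L @ take r ?L"
  let ?b = "rotation (m - r) @ tokens m c @ rotation r"
  have b: "program ?b" by (simp add: program_tokens)
  have "config ?L @ prog_word (tokens m (Loop r c)) \<leadsto>
      config (s r # ?d) @ OPN # prog_word (escape ?b) @ CLS # prog_word (rotation (m - r))"
    using rsteps_context_right[OF sim_rotation[of ?L r],
        of "OPN # prog_word (escape ?b) @ CLS # prog_word (rotation (m - r))"] r rotate_to_front[OF r(1)] by simp
  also have "\<dots> \<leadsto> config (s r # ?d) @ prog_word (rotation (m - r))"
    using rsteps_context[OF sim_loop_exit[OF b], of "HASH # registers ?d" "prog_word (rotation (m - r))"]
      exec_Loop_end by (simp add: config_def)
  also have "\<dots> \<leadsto> config (rotate (m - r) (s r # ?d))"
    by (rule sim_rotation) simp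
  also have "rotate (m - r) (s r # ?d) = ?L"
    using rotate_back[OF r(1), of "s r"] r by (simp add: map_upt_update)
  finally show ?case .
next
  case (exec_Loop s r c s' s'')
  let ?L = "map s [0..<m]"
  have r: "r < length ?L" "?L \<noteq> []" using exec_Loop by auto
  let ?d = "drop (Suc r) ?L @ take r ?L"
  let ?b = "rotation (m - r) @ tokens m c @ rotation r"
  have b: "program ?b" by (simp add: program_tokens)
  let ?l = "OPN # prog_word (escape ?b) @ [CLS]"
  let ?z = "prog_word (rotation (m - r))"
  obtain k where k: "s r = Suc k" using exec_Loop.hyps(1) by (cases "s r") auto
  have "config ?L @ prog_word (tokens m (Loop r c)) \<leadsto> config (s r # ?d) @ ?l @ ?z"
    using rsteps_context_right[OF sim_rotation[of ?L r], of "?l @ ?z"] r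
      rotate_to_front[OF r(1)] by simp
  also have "\<dots> \<leadsto> config (s r # ?d) @ prog_word ?b @ ?l @ ?z"
    using rsteps_context[OF sim_loop_enter[OF b], of "HASH # registers ?d @ COMMA # replicate k ONE" ?z] k
    by (simp add: config_def replicate_pull)
  also have "\<dots> \<leadsto> config (rotate (m - r) (s r # ?d)) @ prog_word (tokens m c) @ prog_word (rotation r) @ ?l @ ?z"
    using rsteps_context_right[OF sim_rotation[of "s r # ?d" "m - r"],
        of "prog_word (tokens m c) @ prog_word (rotation r) @ ?l @ ?z"] by simp
  also have "rotate (m - r) (s r # ?d) = ?L"
    using rotate_back[OF r(1), of "s r"] r by (simp add: map_upt_update)
  also have "config ?L @ prog_word (tokens m c) @ prog_word (rotation r) @ ?l @ ?z \<leadsto>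
      config (map s' [0..<m]) @ prog_word (rotation r) @ ?l @ ?z"
    using rsteps_context_right[OF exec_Loop.IH(1), of "prog_word (rotation r) @ ?l @ ?z"] exec_Loop.prems
    by simp
  \<comment> \<open>What is left of the program, \<open>prog_word (rotation r) @ ?l @ ?z\<close>, is
    the word of the whole loop again, now facing the registers of \<open>s'\<close>.\<close>
  also have "\<dots> \<leadsto> config (map s'' [0..<m])"
    using exec_Loop.IH(2)[OF exec_Loop.prems] by simp
  finally show ?case .
qed

section \<open>Compiling recursive functions\<close>

abbreviation clear :: "nat \<Rightarrow> com" where "clear r \<equiv> Loop r (Dec r)"

definition copy :: "nat \<Rightarrow> nat \<Rightarrow> nat \<Rightarrow> com" where
  "copy a d t = Seq (Loop a (Seq (Dec a) (Inc t))) (Loop t (Seq (Dec t) (Seq (Inc a) (Inc d))))"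

lemma exec_clear: "exec (clear r) s (s(r := 0))"
proof (induction "s r" arbitrary: s)
  case 0
  then show ?case using exec_Loop_end[of s r "Dec r"] by (simp add: fun_upd_idem)
next
  case (Suc k)
  have "exec (clear r) (s(r := k)) (s(r := 0))" using Suc(1)[of "s(r := k)"] by simp
  then show ?case using exec_Loop exec_Dec Suc(2) by (metis nat.distinct(1))
qed

lemma exec_move:
  assumes "a \<noteq> t"
  shows "exec (Loop a (Seq (Dec a) (Inc t))) s (s(a := 0, t := s t + s a))"
proof (induction "s a" arbitrary: s)
  case 0
  then have e: "s(a := 0, t := s t + s a) = s" by auto
  show ?case unfolding e by (rule exec_Loop_end) (use 0 in simp)
next
  case (Suc k)
  let ?s = "s(a := k, t := Suc (s t))"
  have "exec (Seq (Dec a) (Inc t)) s ?s"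
    using exec_Seq[OF exec_Dec exec_Inc, of s a k t] Suc(2) assms by simp
  moreover have "exec (Loop a (Seq (Dec a) (Inc t))) ?s (?s(a := 0, t := ?s t + ?s a))"
    using assms by (intro Suc(1)) simp_all
  moreover have "?s(a := 0, t := ?s t + ?s a) = s(a := 0, t := s t + s a)"
    using Suc(2) assms by auto
  ultimately show ?case using exec_Loop Suc(2) by (metis nat.distinct(1))
qed

lemma exec_copy:
  assumes "a \<noteq> t" "d \<noteq> t" "a \<noteq> d" "s t = 0"
  shows "exec (copy a d t) s (s(d := s d + s a))"
proof -
  have 2: "exec (Loop t (Seq (Dec t) (Seq (Inc a) (Inc d)))) s (s(t := 0, a := s a + s t, d := s d + s t))" for s
  proof (induction "s t" arbitrary: s)
    case 0
    then have e: "s(t := 0, a := s a + s t, d := s d + s t) = s" by auto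
    show ?case unfolding e by (rule exec_Loop_end) (use 0 in simp)
  next
    case (Suc k)
    let ?s = "s(t := k, a := Suc (s a), d := Suc (s d))"
    have "exec (Seq (Dec t) (Seq (Inc a) (Inc d))) s ?s"
      using exec_Seq[OF exec_Dec exec_Seq[OF exec_Inc exec_Inc], of s t k a d] Suc(2) assms by simp
    moreover have "exec (Loop t (Seq (Dec t) (Seq (Inc a) (Inc d)))) ?s
        (?s(t := 0, a := ?s a + ?s t, d := ?s d + ?s t))"
      using assms by (intro Suc(1)) simp_all
    moreover have "?s(t := 0, a := ?s a + ?s t, d := ?s d + ?s t) =
        s(t := 0, a := s a + s t, d := s d + s t)"
      using Suc(2) assms by auto
    ultimately show ?case using exec_Loop Suc(2) by (metis nat.distinct(1))
  qed
  let ?s = "s(a := 0, t := s t + s a)"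
  have "?s(t := 0, a := ?s a + ?s t, d := ?s d + ?s t) = s(d := s d + s a)"
    using assms by auto
  then show ?thesis
    unfolding copy_def using exec_Seq[OF exec_move[OF assms(1), of s] 2[of ?s]] by simp
qed

primrec clears :: "nat \<Rightarrow> nat \<Rightarrow> com" where
  "clears b 0 = Skip"
| "clears b (Suc k) = Seq (clear b) (clears (Suc b) k)"

lemma exec_clears: "exec (clears b k) s (\<lambda>r. if b \<le> r \<and> r < b + k then 0 else s r)"
proof (induction k arbitrary: b s)
  case 0
  have "(\<lambda>r. if b \<le> r \<and> r < b + 0 then 0 else s r) = s" by auto
  then show ?case unfolding clears.simps by (simp only: exec_Skip)
next
  case (Suc k)
  have "(\<lambda>r. if Suc b \<le> r \<and> r < Suc b + k then 0 else (s(b := 0)) r) =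
      (\<lambda>r. if b \<le> r \<and> r < b + Suc k then 0 else s r)"
    by (auto simp: fun_eq_iff)
  then show ?case using exec_Seq[OF exec_clear[of b s] Suc[of "Suc b" "s(b := 0)"]] by simp
qed

text \<open>The registers from \<open>b\<close> on are scratch space, found and left at zero, and
  only \<open>d\<close> changes; so compiled pieces can be nested freely. Nothing is claimed where
  \<open>f\<close> has no value: the diagonal argument only runs programs that halt.\<close>

definition computes :: "com \<Rightarrow> recf \<Rightarrow> nat list \<Rightarrow> nat \<Rightarrow> nat \<Rightarrow> bool" where
  "computes c f args d b \<longleftrightarrow> (\<forall>s z. rec_eval f (map s args) z \<longrightarrow> s d = 0 \<longrightarrow> (\<forall>r\<ge>b. s r = 0) \<longrightarrow>
     exec c s (s(d := z)))"

lemma computesD: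
  "computes c f args d b \<Longrightarrow> rec_eval f (map s args) z \<Longrightarrow> s d = 0 \<Longrightarrow> (\<And>r. b \<le> r \<Longrightarrow> s r = 0) \<Longrightarrow>
     s' = s(d := z) \<Longrightarrow> exec c s s'"
  by (simp add: computes_def)

lemma PrimRec_below:
  assumes "rec_eval (PrimRec f g) (n # xs) z" "i \<le> n"
  shows "\<exists>y. rec_eval (PrimRec f g) (i # xs) y"
  using assms
proof (induction n arbitrary: z)
  case (Suc n)
  then show ?case by (auto simp: le_Suc_eq elim: rec_eval_PrimRec_SucE)
qed auto

text \<open>The results of \<open>gs\<close> are stored from register \<open>b\<close> on. Each one
  moves the start of the scratch space up by one and is thereby protected from the code of the
  following functions.\<close>

lemma computes_Comp:
  assumes IH: "\<And>g d b. g \<in> set gs \<Longrightarrow> set args \<subseteq> {..<b} \<Longrightarrow> d < b \<Longrightarrow> d \<notin> set args \<Longrightarrow>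
      \<exists>c. computes c g args d b"
    and "set args \<subseteq> {..<b}"
  shows "\<exists>c. \<forall>s ys. list_all2 (\<lambda>g y. rec_eval g (map s args) y) gs ys \<longrightarrow> (\<forall>r\<ge>b. s r = 0) \<longrightarrow>
      exec c s (\<lambda>r. if b \<le> r \<and> r < b + length gs then ys ! (r - b) else s r)"
  using assms
proof (induction gs arbitrary: b)
  case Nil
  have "(\<lambda>r. if b \<le> r \<and> r < b + length ([] :: recf list) then ys ! (r - b) else s r) = s"
    for s :: "nat \<Rightarrow> nat" and ys by (auto simp: fun_eq_iff)
  then show ?case by (intro exI[of _ Skip] allI impI) (simp only: exec_Skip)
next
  case (Cons g gs)
  have sub: "set args \<subseteq> {..<Suc b}" "b \<notin> set args" using Cons.prems(2) by auto
  obtain c where c: "computes c g args b (Suc b)"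
    using Cons.prems(1)[of g "Suc b" b] sub by auto
  obtain c' where c': "\<And>s ys. list_all2 (\<lambda>g y. rec_eval g (map s args) y) gs ys \<Longrightarrow>
      (\<forall>r\<ge>Suc b. s r = 0) \<Longrightarrow>
      exec c' s (\<lambda>r. if Suc b \<le> r \<and> r < Suc b + length gs then ys ! (r - Suc b) else s r)"
    using Cons.IH[of "Suc b", OF Cons.prems(1) sub(1)] by (auto simp del: fun_upd_apply)
  have "exec (Seq c c') s (\<lambda>r. if b \<le> r \<and> r < b + length (g # gs) then ys ! (r - b) else s r)"
    if ys: "list_all2 (\<lambda>g y. rec_eval g (map s args) y) (g # gs) ys" and s: "\<forall>r\<ge>b. s r = 0" for s ys
  proof -
    obtain y ys' where y: "ys = y # ys'" "rec_eval g (map s args) y"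
      "list_all2 (\<lambda>g y. rec_eval g (map s args) y) gs ys'"
      using ys by (auto simp: list_all2_Cons1)
    let ?s = "s(b := y)"
    have 1: "exec c s ?s" using computesD[OF c y(2)] s by simp
    have 2: "exec c' ?s
        (\<lambda>r. if Suc b \<le> r \<and> r < Suc b + length gs then ys' ! (r - Suc b) else ?s r)"
    proof (rule c')
      have "map ?s args = map s args" using sub(2) by auto
      then show "list_all2 (\<lambda>g y. rec_eval g (map ?s args) y) gs ys'" using y(3) by metis
    qed (use s in simp)
    have 3: "(\<lambda>r. if Suc b \<le> r \<and> r < Suc b + length gs then ys' ! (r - Suc b) else ?s r) =
        (\<lambda>r. if b \<le> r \<and> r < b + length (g # gs) then ys ! (r - b) else s r)"
    proof
      fix r
      show "(if Suc b \<le> r \<and> r < Suc b + length gs then ys' ! (r - Suc b) else ?s r) =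
        (if b \<le> r \<and> r < b + length (g # gs) then ys ! (r - b) else s r)"
      proof (cases "b < r")
        case True
        then obtain j where "r = Suc (b + j)" using less_imp_Suc_add by blast
        then show ?thesis by (simp add: y(1))
      qed (auto simp: y(1))
    qed
    show ?thesis using exec_Seq[OF 1 2] unfolding 3 .
  qed
  then show ?case by blast
qed

text \<open>Register \<open>b\<close> counts the stages done, \<open>b + 2\<close> those still to
  do, \<open>d\<close> holds the current value, and \<open>b + 1\<close> receives the next one
  before it is moved to \<open>d\<close>. The code for \<open>g\<close> may read \<open>b\<close>
  and \<open>d\<close>, so its scratch space starts at \<open>b + 3\<close>.\<close>

lemma computes_PrimRec:
  assumes args: "set (a # as) \<subseteq> {..<b}" "d < b" "d \<notin> set (a # as)"
    and cf: "computes cf f as d b"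
    and cg: "computes cg g (b # d # as) (b + 1) (b + 3)"
  shows "\<exists>c. computes c (PrimRec f g) (a # as) d b"
proof -
  define body where "body = Seq (Dec (b + 2)) (Seq cg (Seq (clear d)
    (Seq (Loop (b + 1) (Seq (Dec (b + 1)) (Inc d))) (Inc b))))"
  have loop: "exec (Loop (b + 2) body) (s(d := y, b := i, b + 2 := k)) (s(d := z, b := n, b + 2 := 0))"
    if "i + k = n" and s: "\<And>r. b \<le> r \<Longrightarrow> s r = 0"
      and y: "rec_eval (PrimRec f g) (i # map s as) y"
      and z: "rec_eval (PrimRec f g) (n # map s as) z" for s i k n y z
    using that(1) y
  proof (induction k arbitrary: i y)
    case 0
    then show ?case using rec_eval_deterministic[OF _ z] exec_Loop_end[of _ "b + 2" body] by simp
  next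
    case (Suc k)
    obtain y' where y': "rec_eval (PrimRec f g) (Suc i # map s as) y'"
      using PrimRec_below[OF z, of "Suc i"] Suc.prems(1) by auto
    then have gy: "rec_eval g (i # y # map s as) y'"
      using rec_eval_deterministic[OF Suc.prems(2)] by (auto elim: rec_eval_PrimRec_SucE)
    let ?s0 = "s(d := y, b := i, b + 2 := Suc k)"
    let ?s1 = "s(d := y, b := i, b + 2 := k)"
    let ?s2 = "?s1(b + 1 := y')"
    let ?s3 = "?s2(d := 0)"
    let ?s4 = "s(d := y', b := i, b + 2 := k)"
    let ?s5 = "s(d := y', b := Suc i, b + 2 := k)"
    have "exec (Dec (b + 2)) ?s0 ?s1"
      using exec_Dec[of ?s0 "b + 2" k] by simp
    moreover have "exec cg ?s1 ?s2"
    proof (rule computesD[OF cg])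
      have *: "map ?s1 (b # d # as) = i # y # map s as" using args by auto
      show "rec_eval g (map ?s1 (b # d # as)) y'" unfolding * by (rule gy)
    qed (use args s in auto)
    moreover have "exec (clear d) ?s2 ?s3" by (rule exec_clear)
    moreover have "exec (Loop (b + 1) (Seq (Dec (b + 1)) (Inc d))) ?s3 ?s4"
    proof -
      have "?s3(b + 1 := 0, d := ?s3 d + ?s3 (b + 1)) = ?s4"
        using args s[of "b + 1"] by (auto simp: fun_eq_iff)
      then show ?thesis using exec_move[of "b + 1" d ?s3] args(2) by simp
    qed
    moreover have "exec (Inc b) ?s4 ?s5"
    proof -
      have "?s4(b := Suc (?s4 b)) = ?s5" by (auto simp: fun_eq_iff)
      then show ?thesis using exec_Inc[of b ?s4] by simp
    qed
    ultimately have step: "exec body ?s0 ?s5"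
      unfolding body_def by (intro exec_Seq)
    have "exec (Loop (b + 2) body) ?s5 (s(d := z, b := n, b + 2 := 0))"
      by (rule Suc.IH) (use Suc.prems(1) y' in simp_all)
    then show ?case by (rule exec_Loop[OF _ step, rotated]) simp
  qed
  have "computes (Seq cf (Seq (copy a (b + 2) (b + 1)) (Seq (Loop (b + 2) body) (clear b))))
      (PrimRec f g) (a # as) d b"
    unfolding computes_def
  proof (intro allI impI)
    fix s z assume z: "rec_eval (PrimRec f g) (map s (a # as)) z" and s: "s d = 0" "\<forall>r\<ge>b. s r = 0"
    let ?n = "s a"
    obtain y where y: "rec_eval (PrimRec f g) (0 # map s as) y"
      using PrimRec_below[of f g ?n "map s as" z 0] z by auto
    then have fy: "rec_eval f (map s as) y" by (rule rec_eval_PrimRec_0E)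
    have "exec cf s (s(d := y))" using computesD[OF cf fy] s by simp
    moreover have "exec (copy a (b + 2) (b + 1)) (s(d := y)) (s(d := y, b := 0, b + 2 := ?n))"
    proof -
      let ?s = "s(d := y)"
      have "?s(b + 2 := ?s (b + 2) + ?s a) = s(d := y, b := 0, b + 2 := ?n)"
        using args s by (auto simp: fun_eq_iff)
      then show ?thesis using exec_copy[of a "b + 1" "b + 2" ?s] args s by auto
    qed
    moreover have "exec (Loop (b + 2) body) (s(d := y, b := 0, b + 2 := ?n)) (s(d := z, b := ?n, b + 2 := 0))"
      by (rule loop) (use s y z in auto)
    moreover have "exec (clear b) (s(d := z, b := ?n, b + 2 := 0)) (s(d := z))"
    proof -
      have "s(d := z, b := ?n, b + 2 := 0, b := 0) = s(d := z)"
        using s args by (auto simp: fun_eq_iff)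
      then show ?thesis using exec_clear[of b "s(d := z, b := ?n, b + 2 := 0)"] by simp
    qed
    ultimately show "exec (Seq cf (Seq (copy a (b + 2) (b + 1)) (Seq (Loop (b + 2) body) (clear b)))) s (s(d := z))"
      by (intro exec_Seq)
  qed
  then show ?thesis by blast
qed

text \<open>Register \<open>d\<close> runs through the candidates and \<open>b\<close> holds the
  value of \<open>f\<close> at the current one. The loop on \<open>b\<close> ends at the first zero,
  so \<open>b\<close> is clean at that moment.\<close>

lemma computes_Mu:
  assumes args: "set as \<subseteq> {..<b}" "d < b" "d \<notin> set as"
    and cf: "computes cf f (d # as) b (b + 1)"
  shows "\<exists>c. computes c (Mu f) as d b"
proof -
  define body where "body = Seq (clear b) (Seq (Inc d) cf)"
  have loop: "exec (Loop b body) (s(d := i, b := y)) (s(d := n))"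
    if "i + k = n" and s: "\<And>r. b \<le> r \<Longrightarrow> s r = 0" and y: "rec_eval f (i # map s as) y"
      and n: "rec_eval f (n # map s as) 0" "\<And>m. m < n \<Longrightarrow> \<exists>y. rec_eval f (m # map s as) (Suc y)"
    for s i k n y
    using that(1) y
  proof (induction k arbitrary: i y)
    case 0
    then have "y = 0" "i = n" using rec_eval_deterministic[OF _ n(1)] by auto
    moreover have "s(d := n, b := 0) = s(d := n)" using s args by (auto simp: fun_eq_iff)
    moreover have "exec (Loop b body) (s(d := n)) (s(d := n))"
      using exec_Loop_end s args(2) by simp
    ultimately show ?case by metis
  next
    case (Suc k)
    have y: "y \<noteq> 0"
      using rec_eval_deterministic[OF Suc.prems(2)] n(2)[of i] Suc.prems(1) by fastforce
    obtain y' where y': "rec_eval f (Suc i # map s as) y'"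
      using n(1) n(2)[of "Suc i"] Suc.prems(1) by (cases "Suc i = n") force+
    let ?s0 = "s(d := i, b := y)"
    let ?s1 = "s(d := i)"
    let ?s2 = "s(d := Suc i)"
    have "exec (clear b) ?s0 ?s1"
    proof -
      have "?s0(b := 0) = ?s1" using s args by (auto simp: fun_eq_iff)
      then show ?thesis using exec_clear[of b ?s0] by simp
    qed
    moreover have "exec (Inc d) ?s1 ?s2"
      using exec_Inc[of d ?s1] by simp
    moreover have "exec cf ?s2 (?s2(b := y'))"
    proof (rule computesD[OF cf])
      have *: "map ?s2 (d # as) = Suc i # map s as" using args by auto
      show "rec_eval f (map ?s2 (d # as)) y'" unfolding * by (rule y')
    qed (use args s in auto)
    ultimately have step: "exec body ?s0 (?s2(b := y'))"
      unfolding body_def by (intro exec_Seq)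
    have "exec (Loop b body) (?s2(b := y')) (s(d := n))"
      by (rule Suc.IH) (use Suc.prems(1) y' in simp_all)
    then show ?case by (rule exec_Loop[OF _ step, rotated]) (use y in simp)
  qed
  have "computes (Seq cf (Loop b body)) (Mu f) as d b"
    unfolding computes_def
  proof (intro allI impI)
    fix s z assume z: "rec_eval (Mu f) (map s as) z" and s: "s d = 0" "\<forall>r\<ge>b. s r = 0"
    have n: "rec_eval f (z # map s as) 0" "\<And>m. m < z \<Longrightarrow> \<exists>y. rec_eval f (m # map s as) (Suc y)"
      using z by (auto elim: rec_eval_MuE)
    obtain y where y: "rec_eval f (0 # map s as) y"
      using n(1) n(2)[of 0] by (cases z) auto
    have "exec cf s (s(b := y))"
      using computesD[OF cf, of s y] y s by simp
    moreover have "s(d := 0, b := y) = s(b := y)" using s(1) by auto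
    moreover have "exec (Loop b body) (s(d := 0, b := y)) (s(d := z))"
      by (rule loop[of 0 z]) (use s y n in auto)
    ultimately show "exec (Seq cf (Loop b body)) s (s(d := z))"
      by (auto intro: exec_Seq)
  qed
  then show ?thesis by blast
qed

lemma ex_computes:
  "set args \<subseteq> {..<b} \<Longrightarrow> d < b \<Longrightarrow> d \<notin> set args \<Longrightarrow> \<exists>c. computes c f args d b"
proof (induction f arbitrary: args d b)
  case Zero
  have "s(d := 0) = s" if "s d = 0" for s :: "nat \<Rightarrow> nat" using that by auto
  then have "computes Skip Zero args d b"
    unfolding computes_def using exec_Skip by (metis rec_eval_ZeroE)
  then show ?case by blast
next
  case Succ
  show ?case
  proof (cases args)
    case Nil
    \<comment> \<open>\<open>Succ\<close> has no value on the empty list, so any program meets the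
      specification.\<close>
    then have "computes Skip Succ args d b"
      unfolding computes_def by (auto elim: rec_eval_SuccE)
    then show ?thesis by blast
  next
    case (Cons a as)
    have "exec (Seq (copy a d b) (Inc d)) s (s(d := z))"
      if "rec_eval Succ (map s args) z" "s d = 0" "\<forall>r\<ge>b. s r = 0" for s z
    proof -
      have "z = Suc (s a)" using that(1) Cons by (auto elim: rec_eval_SuccE)
      moreover have "exec (copy a d b) s (s(d := s a))"
        using exec_copy[of a b d s] that Succ Cons by auto
      ultimately show ?thesis
        using exec_Seq[OF _ exec_Inc[of d "s(d := s a)"]] by simp
    qed
    then show ?thesis unfolding computes_def by blast
  qed
next
  case (Proj i)
  show ?case
  proof (cases "i < length args")
    case True
    have "exec (copy (args ! i) d b) s (s(d := z))"
      if "rec_eval (Proj i) (map s args) z" "s d = 0" "\<forall>r\<ge>b. s r = 0" for s z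
    proof -
      have "z = s (args ! i)" using that(1) True by (auto elim: rec_eval_ProjE)
      moreover have "args ! i < b" "args ! i \<noteq> d" using Proj.prems nth_mem[OF True] by (auto dest: subsetD)
      ultimately show ?thesis
        using exec_copy[of "args ! i" b d s] that Proj by auto
    qed
    then show ?thesis unfolding computes_def by blast
  next
    case False
    then have "computes Skip (Proj i) args d b"
      unfolding computes_def by (auto elim: rec_eval_ProjE)
    then show ?thesis by blast
  qed
next
  case (Comp f gs)
  obtain c where c: "\<And>s ys. list_all2 (\<lambda>g y. rec_eval g (map s args) y) gs ys \<Longrightarrow>
      (\<forall>r\<ge>b. s r = 0) \<Longrightarrow>
      exec c s (\<lambda>r. if b \<le> r \<and> r < b + length gs then ys ! (r - b) else s r)"
    using computes_Comp[of gs args b, OF Comp.IH(2) Comp.prems(1)] by blast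
  obtain c' where c': "computes c' f [b..<b + length gs] d (b + length gs)"
  proof -
    have "set [b..<b + length gs] \<subseteq> {..<b + length gs}" "d \<notin> set [b..<b + length gs]"
      using Comp.prems(2) by auto
    then show thesis using Comp.IH(1)[of _ "b + length gs" d] Comp.prems(2) that by (meson trans_less_add1)
  qed
  have "exec (Seq c (Seq c' (clears b (length gs)))) s (s(d := z))"
    if z: "rec_eval (Comp f gs) (map s args) z" and "s d = 0" "\<forall>r\<ge>b. s r = 0" for s z
  proof -
    obtain ys where ys: "list_all2 (\<lambda>g y. rec_eval g (map s args) y) gs ys" "rec_eval f ys z"
      by (rule rec_eval_CompE[OF z])
    let ?s = "\<lambda>r. if b \<le> r \<and> r < b + length gs then ys ! (r - b) else s r"
    have "length ys = length gs" using ys(1) by (simp add: list_all2_lengthD)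
    then have "map ?s [b..<b + length gs] = ys"
      by (auto intro!: nth_equalityI)
    then have "exec c' ?s (?s(d := z))"
      using computesD[OF c', of ?s z] ys(2) that Comp.prems by simp
    moreover have "exec (clears b (length gs)) (?s(d := z)) (s(d := z))"
    proof -
      have "(\<lambda>r. if b \<le> r \<and> r < b + length gs then 0 else (?s(d := z)) r) = s(d := z)"
        using that Comp.prems by (auto simp: fun_eq_iff)
      then show ?thesis using exec_clears[of b "length gs" "?s(d := z)"] by simp
    qed
    ultimately show ?thesis using c[OF ys(1)] that(3) by (auto intro: exec_Seq)
  qed
  then show ?case unfolding computes_def by blast
next
  case (PrimRec f g)
  show ?case
  proof (cases args)
    case Nil
    have "\<not> rec_eval (PrimRec f g) [] z" for z
      by (auto elim: rec_eval.cases)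
    then have "computes Skip (PrimRec f g) args d b"
      unfolding computes_def using Nil by simp
    then show ?thesis by blast
  next
    case (Cons a as)
    obtain cf where "computes cf f as d b"
      using PrimRec.IH(1)[of as b d] PrimRec.prems Cons by auto
    moreover obtain cg where "computes cg g (b # d # as) (b + 1) (b + 3)"
    proof -
      have "set (b # d # as) \<subseteq> {..<b + 3}" "b + 1 \<notin> set (b # d # as)"
        using PrimRec.prems Cons by auto
      then show thesis using PrimRec.IH(2)[of "b # d # as" "b + 3" "b + 1"] that by auto
    qed
    ultimately show ?thesis
      using computes_PrimRec[of a as b d cf f cg g] PrimRec.prems Cons by simp
  qed
next
  case (Mu f)
  have "set (d # args) \<subseteq> {..<b + 1}" "b \<notin> set (d # args)"
    using Mu.prems by auto
  then obtain cf where "computes cf f (d # args) b (b + 1)"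
    using Mu.IH[of "d # args" "b + 1" b] by auto
  then show ?case using computes_Mu Mu.prems by blast
qed

lemma registers_replicate_0: "registers (replicate k 0) = replicate k COMMA"
  by (induction k) (auto simp: replicate_append_same)

lemma set_prog_word: "program ts \<Longrightarrow> set (prog_word ts) \<subseteq> {ROT..ESC}"
proof (induction ts)
  case (Cons t ts)
  moreover have "set (replicate k ESC) \<subseteq> {ROT..ESC}" for k by (cases k) auto
  ultimately show ?case by (cases t) (auto simp del: set_replicate dest!: subsetD)
qed simp

theorem simulation:
  fixes f :: recf
  shows "\<exists>w. set w \<subseteq> {1..<36} - {HASH} \<and> (\<forall>n z. rec_eval f [n] z \<longrightarrow>
    (\<exists>y. HASH # COMMA # replicate n ONE @ w \<leadsto> y \<and> normal y \<and> (y = [HASH, HALT] \<longleftrightarrow> z = 0)))"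
proof -
  obtain c0 where c0: "computes c0 f [0] 1 2"
    using ex_computes[of "[0]" 2 1 f] by auto
  \<comment> \<open>\<open>HALT\<close> moves outwards from register 0 and deletes zero registers.
    With the input cleared, only the result in register 1 can stop it.\<close>
  define c where "c = Seq c0 (clear 0)"
  define m where "m = Suc (Max (regs c \<union> {1}))"
  have "r < m" if "r \<in> regs c \<union> {1}" for r
    unfolding m_def less_Suc_eq_le by (rule Max_ge) (use finite_regs[of c] that in simp_all)
  then have m: "regs c \<subseteq> {..<m}" "1 < m" by auto
  obtain m' where m': "m = Suc (Suc m')" using m(2) that[of "m - 2"] by simp
  \<comment> \<open>The input word provides a single register. The commas put \<open>m - 1\<close>
    zero registers in front of it, and the rotation then makes it register 0.\<close>
  define w where "w = replicate (m - 1) COMMA @ prog_word (rotation (m - 1)) @ prog_word (tokens m c) @ [HALT]"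
  have "set w \<subseteq> {1..<36} - {HASH}"
  proof -
    have "{ROT..ESC} \<subseteq> {1..<36} - {HASH}" "set (replicate (m - 1) COMMA) \<subseteq> {1..<36} - {HASH}"
      by auto
    then show ?thesis
      using set_prog_word[OF program_rotation, of "m - 1"] set_prog_word[OF program_tokens[of m c]]
      unfolding w_def set_append by (intro Un_least) (blast | simp)+
  qed
  moreover have "\<exists>y. HASH # COMMA # replicate n ONE @ w \<leadsto> y \<and> normal y \<and> (y = [HASH, HALT] \<longleftrightarrow> z = 0)"
    if "rec_eval f [n] z" for n z
  proof -
    define s :: "nat \<Rightarrow> nat" where "s = (\<lambda>r. 0)(0 := n)"
    define s' :: "nat \<Rightarrow> nat" where "s' = (\<lambda>r. 0)(1 := z)"
    have "exec c0 s (s(1 := z))"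
      using computesD[OF c0, of s z] that by (simp add: s_def)
    moreover have "exec (clear 0) (s(1 := z)) s'"
    proof -
      have "s(1 := z, 0 := 0) = s'" by (auto simp: s_def s'_def)
      then show ?thesis using exec_clear[of 0 "s(1 := z)"] by simp
    qed
    ultimately have "exec c s s'" unfolding c_def by (rule exec_Seq)
    from sim_exec[OF this m(1)]
    have sim: "config (map s [0..<m]) @ prog_word (tokens m c) \<leadsto> config (map s' [0..<m])" .
    have "HASH # COMMA # replicate n ONE @ w =
        config (replicate (m - 1) 0 @ [n]) @ prog_word (rotation (m - 1)) @ prog_word (tokens m c) @ [HALT]"
      by (simp add: w_def config_def registers_append registers_replicate_0)
    also have "\<dots> \<leadsto> config (map s [0..<m]) @ prog_word (tokens m c) @ [HALT]"
    proof -
      have "map s [0..<m] = n # replicate (m - 1) 0"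
        by (rule nth_equalityI) (auto simp: s_def nth_Cons' m' simp del: upt_Suc)
      moreover have "rotate (m - 1) (replicate (m - 1) 0 @ [n]) = n # replicate (m - 1) 0"
        using rotate_append[of "replicate (m - 1) 0" "[n]"] by simp
      ultimately show ?thesis
        using rsteps_context_right[OF sim_rotation[of "replicate (m - 1) 0 @ [n]" "m - 1"],
            of "prog_word (tokens m c) @ [HALT]"] by simp
    qed
    also have "\<dots> \<leadsto> config (map s' [0..<m]) @ [HALT]"
      using rsteps_context_right[OF sim, of "[HALT]"] by simp
    also have "map s' [0..<m] = 0 # z # replicate m' 0"
      by (rule nth_equalityI) (auto simp: s'_def nth_Cons' m' simp del: upt_Suc)
    also have "config (0 # z # replicate m' 0) @ [HALT] =
        (HASH # replicate (Suc m') COMMA @ replicate z ONE) @ [COMMA, HALT]"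
      by (simp add: config_def registers_replicate_0 replicate_pull)
    also have "\<dots> \<leadsto> (HASH # replicate (Suc m') COMMA @ replicate z ONE) @ [HALT]"
      using rsteps_context_left[OF rsteps_rule[of COMMA HALT "[HALT]" "[]"],
          of "HASH # replicate (Suc m') COMMA @ replicate z ONE"] by simp
    finally have main: "HASH # COMMA # replicate n ONE @ w \<leadsto>
        (HASH # replicate (Suc m') COMMA @ replicate z ONE) @ [HALT]" .
    show ?thesis
    proof (cases z)
      case 0
      have "replicate k COMMA @ [HALT] \<leadsto> [HALT]" for k
      proof (induction k)
        case (Suc k)
        from rsteps_Cons[OF this, of COMMA] show ?case
          using rsteps_rule[of COMMA HALT "[HALT]" "[]"] by simp
      qed simp
      from rsteps_Cons[OF this, of HASH "Suc m'"] main
      have "HASH # COMMA # replicate n ONE @ w \<leadsto> [HASH, HALT]"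
        unfolding 0 by simp
      moreover have "normal [HASH, HALT]"
        by (auto simp: normal_iff Cons_eq_append_conv)
      ultimately show ?thesis using 0 by blast
    next
      case (Suc k)
      let ?y = "(HASH # replicate (Suc m') COMMA @ replicate k ONE) @ [ONE, HALT]"
      have "normal ?y"
      proof -
        have "rule p q = None" if "?y = xs @ p # q # ys" for xs p q ys
        proof (cases ys rule: rev_cases)
          case Nil
          then have "xs @ [p, q] = (HASH # replicate (Suc m') COMMA @ replicate k ONE) @ [ONE, HALT]"
            using that by simp
          then have "[p, q] = [ONE, HALT]"
            by (subst (asm) append_eq_append_conv) auto
          then show ?thesis by simp
        next
          case (snoc ys' y')
          then have "q \<in> set (HASH # replicate (Suc m') COMMA @ replicate k ONE @ [ONE])"
            using that by (metis append.assoc append_Cons append_Nil butlast_snoc in_set_conv_decomp)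
          \<comment> \<open>All letters before the final \<open>HALT\<close> are from 20 on and
            cannot be second in a redex.\<close>
          then have "20 \<le> q" by (auto split: if_splits)
          then show ?thesis using rule_SomeD[of p q] by (cases "rule p q") auto
        qed
        then show ?thesis by (simp add: normal_iff)
      qed
      moreover have "HASH # COMMA # replicate n ONE @ w \<leadsto> ?y"
        using main Suc by (simp add: replicate_pull)
      ultimately show ?thesis using Suc by (intro exI[of _ ?y]) auto
    qed
  qed
  ultimately show ?thesis by blast
qed

section \<open>Conjugacy in finitely presented monoids\<close>

context
  fixes \<Sigma> :: "'a set" and R
  assumes R: "R \<subseteq> lists \<Sigma> \<times> lists \<Sigma>"
begin

lemma gen_congruence_refl: "u \<in> lists \<Sigma> \<Longrightarrow> (u, u) \<in> gen_congruence \<Sigma> R"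
  using word_congruence_gen_congruence[OF R] unfolding word_congruence_def equiv_def
  by (meson refl_onD)

lemma gen_congruence_sym: "(u, v) \<in> gen_congruence \<Sigma> R \<Longrightarrow> (v, u) \<in> gen_congruence \<Sigma> R"
  using word_congruence_gen_congruence[OF R] unfolding word_congruence_def equiv_def
  by (meson symD)

lemma gen_congruence_trans:
  "(u, v) \<in> gen_congruence \<Sigma> R \<Longrightarrow> (v, w) \<in> gen_congruence \<Sigma> R \<Longrightarrow> (u, w) \<in> gen_congruence \<Sigma> R"
  using word_congruence_gen_congruence[OF R] unfolding word_congruence_def equiv_def
  by (meson transD)

lemma gen_congruence_append:
  "(u, v) \<in> gen_congruence \<Sigma> R \<Longrightarrow> (x, y) \<in> gen_congruence \<Sigma> R \<Longrightarrow> (u @ x, v @ y) \<in> gen_congruence \<Sigma> R"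
  using word_congruence_gen_congruence[OF R] unfolding word_congruence_def by blast

lemma gen_congruence_rule: "(u, v) \<in> R \<Longrightarrow> (u, v) \<in> gen_congruence \<Sigma> R"
  by (auto simp: gen_congruence_def)

lemma gen_congruence_context:
  "(u, v) \<in> gen_congruence \<Sigma> R \<Longrightarrow> x \<in> lists \<Sigma> \<Longrightarrow> y \<in> lists \<Sigma> \<Longrightarrow>
     (x @ u @ y, x @ v @ y) \<in> gen_congruence \<Sigma> R"
  by (intro gen_congruence_append gen_congruence_refl)

text \<open>The relation \<open>\<rho>\<close> of having equal \<open>f\<close>-values in every
  context is the syntactic congruence of \<open>f\<close>. It contains \<open>R\<close> by
  assumption, hence the generated congruence, and the empty context gives the claim.\<close>

lemma gen_congruence_invariant:
  assumes f: "\<And>l r x y. (l, r) \<in> R \<Longrightarrow> x \<in> lists \<Sigma> \<Longrightarrow> y \<in> lists \<Sigma> \<Longrightarrow> f (x @ l @ y) = f (x @ r @ y)"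
    and uv: "(u, v) \<in> gen_congruence \<Sigma> R"
  shows "f u = f v"
proof -
  define \<rho> where "\<rho> = {(u, v). u \<in> lists \<Sigma> \<and> v \<in> lists \<Sigma> \<and>
    (\<forall>x\<in>lists \<Sigma>. \<forall>y\<in>lists \<Sigma>. f (x @ u @ y) = f (x @ v @ y))}"
  have "(u @ u', v @ v') \<in> \<rho>" if "(u, v) \<in> \<rho>" "(u', v') \<in> \<rho>" for u v u' v'
  proof -
    have "f (x @ (u @ u') @ y) = f (x @ (v @ v') @ y)" if "x \<in> lists \<Sigma>" "y \<in> lists \<Sigma>" for x y
    proof -
      have "f (x @ u @ (u' @ y)) = f (x @ v @ (u' @ y))"
        using \<open>(u, v) \<in> \<rho>\<close> \<open>(u', v') \<in> \<rho>\<close> that unfolding \<rho>_def by (simp del: append_assoc)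
      also have "\<dots> = f ((x @ v) @ v' @ y)"
        using \<open>(u, v) \<in> \<rho>\<close> \<open>(u', v') \<in> \<rho>\<close> that unfolding \<rho>_def append_assoc[of x v, symmetric]
        by (simp del: append_assoc)
      finally show ?thesis by simp
    qed
    then show ?thesis using that unfolding \<rho>_def by simp
  qed
  moreover have "equiv (lists \<Sigma>) \<rho>"
    by (auto simp: equiv_def refl_on_def sym_def trans_def \<rho>_def)
  ultimately have "word_congruence \<Sigma> \<rho>" unfolding word_congruence_def by blast
  moreover have "R \<subseteq> \<rho>" using R f unfolding \<rho>_def by fast
  ultimately have "(u, v) \<in> \<rho>" using uv unfolding gen_congruence_def by blast
  then have "f ([] @ u @ []) = f ([] @ v @ [])" unfolding \<rho>_def by blast
  then show ?thesis by simp
qed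

lemma carrier_presented_monoid: "carrier (presented_monoid \<Sigma> R) = word_class \<Sigma> R ` lists \<Sigma>"
  by (auto simp: presented_monoid_def quotient_def word_class_def)

text \<open>One direction of \<open>c\<close>-conjugacy, without the condition that is vacuous if there is no zero.\<close>

definition conj_to :: "'a list \<Rightarrow> 'a list \<Rightarrow> bool" where
  "conj_to u v \<longleftrightarrow> (\<exists>g\<in>lists \<Sigma>. (u @ g, g @ v) \<in> gen_congruence \<Sigma> R)"

lemma conj_to_refl: "u \<in> lists \<Sigma> \<Longrightarrow> conj_to u u"
  unfolding conj_to_def by (intro bexI[of _ "[]"]) (auto intro: gen_congruence_refl)

lemma conj_to_trans:
  assumes "conj_to u v" "conj_to v w"
  shows "conj_to u w"
proof -
  obtain g h where g: "g \<in> lists \<Sigma>" "(u @ g, g @ v) \<in> gen_congruence \<Sigma> R"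
    and h: "h \<in> lists \<Sigma>" "(v @ h, h @ w) \<in> gen_congruence \<Sigma> R"
    using assms unfolding conj_to_def by blast
  have "(u @ g @ h, g @ v @ h) \<in> gen_congruence \<Sigma> R"
    using gen_congruence_context[OF g(2), of "[]" h] h by simp
  moreover have "(g @ v @ h, g @ h @ w) \<in> gen_congruence \<Sigma> R"
    using gen_congruence_context[OF h(2), of g "[]"] g by simp
  ultimately show ?thesis
    unfolding conj_to_def using g h gen_congruence_trans by (intro bexI[of _ "g @ h"]) auto
qed

lemma c_conjugate_iff:
  assumes "\<nexists>z. is_zero (presented_monoid \<Sigma> R) z" "u \<in> lists \<Sigma>" "v \<in> lists \<Sigma>"
  shows "c_conjugate (presented_monoid \<Sigma> R) (word_class \<Sigma> R u) (word_class \<Sigma> R v) \<longleftrightarrow>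
    conj_to u v \<and> conj_to v u"
proof -
  let ?M = "presented_monoid \<Sigma> R"
  have "word_class \<Sigma> R a \<otimes>\<^bsub>?M\<^esub> word_class \<Sigma> R g = word_class \<Sigma> R g \<otimes>\<^bsub>?M\<^esub> word_class \<Sigma> R b \<longleftrightarrow>
      (a @ g, g @ b) \<in> gen_congruence \<Sigma> R"
    if "a \<in> lists \<Sigma>" "b \<in> lists \<Sigma>" "g \<in> lists \<Sigma>" for a b g
    using that by (simp add: presented_monoid_mult[OF R] word_class_eq_iff[OF R])
  then show ?thesis
    using assms unfolding c_conjugate_def c_conjugators_def conj_to_def
    by (simp add: carrier_presented_monoid)
qed

text \<open>The relations preserve the number of letters in \<open>E\<close>, multiplication by
  \<open>e\<close> raises it, and a zero would absorb \<open>e\<close>. For \<open>R2\<close> the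
  letter 36 is counted, for the first monoid the signals.\<close>

lemma no_zeroI:
  assumes E: "\<And>l r. (l, r) \<in> R \<Longrightarrow> length (filter E l) = length (filter E r)"
    and e: "e \<in> \<Sigma>" "E e"
  shows "\<nexists>z. is_zero (presented_monoid \<Sigma> R) z"
proof
  assume "\<exists>z. is_zero (presented_monoid \<Sigma> R) z"
  then obtain u where u: "u \<in> lists \<Sigma>" "is_zero (presented_monoid \<Sigma> R) (word_class \<Sigma> R u)"
    unfolding is_zero_def carrier_presented_monoid by blast
  have "word_class \<Sigma> R u \<otimes>\<^bsub>presented_monoid \<Sigma> R\<^esub> word_class \<Sigma> R [e] = word_class \<Sigma> R u"
    using u(2) e unfolding is_zero_def carrier_presented_monoid by auto
  then have "(u @ [e], u) \<in> gen_congruence \<Sigma> R"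
    using u(1) e by (simp add: presented_monoid_mult[OF R] word_class_eq_iff[OF R])
  then have "length (filter E (u @ [e])) = length (filter E u)"
    by (rule gen_congruence_invariant[rotated]) (use E in simp)
  then show False using e by simp
qed

end

section \<open>Undecidable word problem and decidable conjugacy problem\<close>

definition rules :: "(nat list \<times> nat list) set" where
  "rules = {([p, q], r) | p q r. rule p q = Some r}"

lemma finite_rules: "finite rules"
proof -
  have "rules \<subseteq> (\<lambda>(p, q). ([p, q], the (rule p q))) ` ({..<36} \<times> {..<36})"
    by (fastforce simp: rules_def image_iff dest: rule_SomeD)
  then show ?thesis by (rule finite_subset) simp
qed

lemma rules_lists: "rules \<subseteq> lists {..<36} \<times> lists {..<36}"
  by (force simp: rules_def dest: rule_SomeD)

lemma rsteps_set:
  "u \<leadsto> v \<Longrightarrow> set u \<subseteq> {1..<36} \<Longrightarrow> set v \<subseteq> {1..<36}"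
proof (induction rule: rtranclp_induct)
  case (step v w)
  from step(2,3,4) show ?case
    by cases (fastforce dest: rule_SomeD)
qed

lemma rsteps_gen_congruence:
  assumes R: "R \<subseteq> lists \<Sigma> \<times> lists \<Sigma>" "rules \<subseteq> R" and "{..<36} \<subseteq> \<Sigma>"
    and "u \<leadsto> v" "set u \<subseteq> {1..<36}"
  shows "(u, v) \<in> gen_congruence \<Sigma> R"
  using assms(4,5)
proof (induction rule: rtranclp_induct)
  case base
  then show ?case using assms(3) by (intro gen_congruence_refl[OF R(1)]) fastforce
next
  case (step v w)
  have v: "set v \<subseteq> \<Sigma>"
    using rsteps_set[OF step(1) step.prems] assms(3) by fastforce
  from step(2) have "(v, w) \<in> gen_congruence \<Sigma> R"
  proof cases
    case (rstepI p q r x y)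
    then have "([p, q], r) \<in> gen_congruence \<Sigma> R"
      using R(2) by (intro gen_congruence_rule[OF R(1)]) (auto simp: rules_def)
    from gen_congruence_context[OF R(1) this, of x y] show ?thesis
      using v rstepI by auto
  qed
  then show ?case using step.IH step.prems gen_congruence_trans[OF R(1)] by blast
qed

text \<open>The letter \<open>e\<close> is 36.\<close>

definition R2 :: "(nat list \<times> nat list) set" where
  "R2 = rules \<union> (\<lambda>a. ([a, 36], [36])) ` {..<36} \<union> (\<lambda>a. ([36, a], [36])) ` {..<36}"

lemma R2_lists: "R2 \<subseteq> lists {..<37} \<times> lists {..<37}"
proof -
  have "lists {..<36 :: nat} \<subseteq> lists {..<37}" by (intro lists_mono) auto
  then show ?thesis using rules_lists unfolding R2_def by auto
qed

lemma finite_R2: "finite R2"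
  by (simp add: R2_def finite_rules)

lemma rules_count: "(l, r) \<in> rules \<Longrightarrow> 36 \<notin> set l \<and> 36 \<notin> set r"
  using rules_lists by fastforce

lemma R2_count: "(l, r) \<in> R2 \<Longrightarrow> length (filter (\<lambda>a. a = 36) l) = length (filter (\<lambda>a. a = 36) r)"
proof -
  assume "(l, r) \<in> R2"
  moreover have "filter (\<lambda>a. a = 36) x = []" if "36 \<notin> set x" for x :: "nat list"
    using that by (auto simp: filter_empty_conv)
  ultimately show ?thesis using rules_count[of l r] by (auto simp: R2_def)
qed

lemma R2_absorb:
  assumes "set u \<subseteq> {..<36}"
  shows "(u @ [36], [36]) \<in> gen_congruence {..<37} R2" "(36 # u, [36]) \<in> gen_congruence {..<37} R2"
proof -
  note ctx = gen_congruence_context[OF R2_lists]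
  show "(u @ [36], [36]) \<in> gen_congruence {..<37} R2"
    using assms
  proof (induction u)
    case Nil
    show ?case using gen_congruence_refl[OF R2_lists] by simp
  next
    case (Cons a u)
    then have "(a # u @ [36], [a, 36]) \<in> gen_congruence {..<37} R2"
      using ctx[of "u @ [36]" "[36]" "[a]" "[]"] by simp
    moreover have "([a, 36], [36]) \<in> gen_congruence {..<37} R2"
      using Cons.prems by (intro gen_congruence_rule[OF R2_lists]) (auto simp: R2_def)
    ultimately show ?case using gen_congruence_trans[OF R2_lists] by simp
  qed
  show "(36 # u, [36]) \<in> gen_congruence {..<37} R2"
    using assms
  proof (induction u)
    case Nil
    show ?case using gen_congruence_refl[OF R2_lists] by simp
  next
    case (Cons a u)
    have "([36, a], [36]) \<in> gen_congruence {..<37} R2"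
      using Cons.prems by (intro gen_congruence_rule[OF R2_lists]) (auto simp: R2_def)
    from ctx[OF this, of "[]" u] have "(36 # a # u, 36 # u) \<in> gen_congruence {..<37} R2"
      using Cons.prems by fastforce
    then show ?case using Cons gen_congruence_trans[OF R2_lists] by simp
  qed
qed

lemma R2_collapse:
  assumes "set u \<subseteq> {..<37}" "36 \<in> set u"
  shows "(u, replicate (length (filter (\<lambda>a. a = 36) u)) 36) \<in> gen_congruence {..<37} R2"
  using assms
proof (induction u)
  case (Cons a u)
  note ctx = gen_congruence_context[OF R2_lists] and trans = gen_congruence_trans[OF R2_lists]
  show ?case
  proof (cases "36 \<in> set u")
    case False
    then have "a = 36" "filter (\<lambda>a. a = 36) u = []" "set u \<subseteq> {..<36}"
      using Cons.prems by (auto simp: filter_empty_conv less_Suc_eq numeral_eq_Suc)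
    then show ?thesis using R2_absorb(2)[of u] by (simp only: filter.simps if_True list.size) simp
  next
    case True
    let ?n = "length (filter (\<lambda>a. a = 36) u)"
    have IH: "(a # u, a # replicate ?n 36) \<in> gen_congruence {..<37} R2"
      using ctx[OF Cons.IH, of "[a]" "[]"] Cons.prems True by simp
    show ?thesis
    proof (cases "a = 36")
      case False
      then have "([a, 36], [36]) \<in> gen_congruence {..<37} R2"
        using R2_absorb(1)[of "[a]"] Cons.prems by auto
      moreover obtain k where "?n = Suc k"
        using True by (cases ?n) (auto simp: filter_empty_conv)
      ultimately have "(a # replicate ?n 36, replicate ?n 36) \<in> gen_congruence {..<37} R2"
        using ctx[of "[a, 36]" "[36]" "[]" "replicate k 36"]
        by (simp add: in_lists_conv_set)
      then show ?thesis using trans[OF IH] False by simp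
    qed (use IH in simp)
  qed
qed simp

lemma R2_conj_to:
  assumes "u \<in> lists {..<37}" "v \<in> lists {..<37}"
  shows "conj_to {..<37} R2 u v \<longleftrightarrow>
    length (filter (\<lambda>a. a = 36) u) = length (filter (\<lambda>a. a = 36) v)" (is "_ \<longleftrightarrow> ?c u = ?c v")
proof
  assume "conj_to {..<37} R2 u v"
  then obtain g where "(u @ g, g @ v) \<in> gen_congruence {..<37} R2"
    unfolding conj_to_def[OF R2_lists] by blast
  then have "?c (u @ g) = ?c (g @ v)"
    by (rule gen_congruence_invariant[OF R2_lists, rotated]) (use R2_count in simp)
  then show "?c u = ?c v" by simp
next
  assume eq: "?c u = ?c v"
  note trans = gen_congruence_trans[OF R2_lists] and sym = gen_congruence_sym[OF R2_lists]
  have mem: "36 \<in> set w \<longleftrightarrow> ?c w \<noteq> 0" for w by (induction w) auto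
  show "conj_to {..<37} R2 u v"
  proof (cases "36 \<in> set u")
    case True
    moreover from this have "36 \<in> set v"
      using eq by (simp add: mem)
    ultimately have "(u, v) \<in> gen_congruence {..<37} R2"
      using trans[OF R2_collapse[of u] sym[OF R2_collapse[of v], folded eq]] assms
      by (simp add: in_lists_conv_set subset_eq)
    then show ?thesis unfolding conj_to_def[OF R2_lists] by (intro bexI[of _ "[]"]) auto
  next
    case False
    moreover from this have "36 \<notin> set v"
      using eq by (simp add: mem)
    ultimately have "set u \<subseteq> {..<36}" "set v \<subseteq> {..<36}"
      using assms by (auto simp: less_Suc_eq numeral_eq_Suc)
    \<comment> \<open>Here \<open>u e = e = e v\<close>, so the single letter \<open>e\<close>
      conjugates any two words without \<open>e\<close>, whatever elements they represent.\<close>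
    from trans[OF R2_absorb(1)[OF this(1)] sym[OF R2_absorb(2)[OF this(2)]]]
    show ?thesis unfolding conj_to_def[OF R2_lists] by (intro bexI[of _ "[36]"]) auto
  qed
qed

lemma c_conjugacy_decidable_R2: "c_conjugacy_problem_decidable {..<37} R2"
  unfolding c_conjugacy_problem_decidable_def
proof (rule decidable_on_wordsI)
  let ?g = "\<lambda>l. foldl (\<lambda>c x. if x = 36 then Suc c else c) 0 (list_decode l)"
  show "computable 1 (\<lambda>xs. ?g (xs ! 0))"
    by (intro computable_foldl computable_if_eq computable_Suc computable_const computable_nth) auto
  have "foldl (\<lambda>c x. if x = 36 then Suc c else c) n u = n + length (filter (\<lambda>a. a = 36) u)"
    for n and u :: "nat list"
    by (induction u arbitrary: n) auto
  moreover have "\<nexists>z. is_zero (presented_monoid {..<37} R2) z"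
    by (rule no_zeroI[OF R2_lists R2_count]) auto
  ultimately show "c_conjugate (presented_monoid {..<37} R2) (word_class {..<37} R2 u) (word_class {..<37} R2 v)
      \<longleftrightarrow> ?g (list_encode u) = ?g (list_encode v)"
    if "u \<in> lists {..<37}" "v \<in> lists {..<37}" for u v
    using that by (auto simp: c_conjugate_iff[OF R2_lists] R2_conj_to)
qed

text \<open>Sending all words with an \<open>e\<close> to one common value and every other word to
  its \<open>S\<close>-class is invariant under \<open>R2\<close>, so adjoining \<open>e\<close>
  identifies no further words of \<open>S\<close>.\<close>

lemma R2_conv:
  assumes "(u, v) \<in> gen_congruence {..<37} R2" "36 \<notin> set u" "36 \<notin> set v"
  shows "conv u v"
proof -
  define f where "f u = (if 36 \<in> set u then {} else {w. conv u w})" for u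
  have "f (x @ l @ y) = f (x @ r @ y)" if "(l, r) \<in> R2" for l r x y
  proof (cases "(l, r) \<in> rules")
    case True
    then obtain p q where "l = [p, q]" "rule p q = Some r" by (auto simp: rules_def)
    then have c: "conv (x @ l @ y) (x @ r @ y)"
      using rstepI[of p q r x y] by (auto intro: rstep_conv)
    then have "{w. conv (x @ l @ y) w} = {w. conv (x @ r @ y) w}"
      using conv_trans conv_sym by blast
    then show ?thesis using rules_count[OF True] by (simp add: f_def)
  next
    case False
    then show ?thesis using that by (auto simp: R2_def f_def)
  qed
  then have "f u = f v" by (rule gen_congruence_invariant[OF R2_lists _ assms(1)])
  moreover have "conv v v" by (simp add: conv_def)
  ultimately show ?thesis using assms(2,3) by (auto simp: f_def)
qed

lemma not_word_problem_decidable_R2: "\<not> word_problem_decidable {..<37} R2"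
  unfolding word_problem_decidable_def
proof (rule not_decidable_on_words[where c = "[HASH, COMMA]" and x = ONE and v = "[HASH, HALT]"])
  fix f
  obtain w where w: "set w \<subseteq> {1..<36} - {HASH}" "\<And>n z. rec_eval f [n] z \<Longrightarrow>
      \<exists>y. HASH # COMMA # replicate n ONE @ w \<leadsto> y \<and> normal y \<and> (y = [HASH, HALT] \<longleftrightarrow> z = 0)"
    using simulation[of f] by blast
  have "word_class {..<37} R2 ([HASH, COMMA] @ replicate n ONE @ w) = word_class {..<37} R2 [HASH, HALT]
      \<longleftrightarrow> z = 0" if z: "rec_eval f [n] z" for n z
  proof -
    let ?u = "HASH # COMMA # replicate n ONE @ w"
    have u: "set ?u \<subseteq> {1..<36}" using w(1) by auto
    obtain y where y: "?u \<leadsto> y" "normal y" "y = [HASH, HALT] \<longleftrightarrow> z = 0" using w(2)[OF z] by blast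
    have nf: "normal [HASH, HALT]" by (auto simp: normal_iff Cons_eq_append_conv)
    have "(?u, [HASH, HALT]) \<in> gen_congruence {..<37} R2 \<longleftrightarrow> z = 0"
    proof
      assume "(?u, [HASH, HALT]) \<in> gen_congruence {..<37} R2"
      then have "conv ?u [HASH, HALT]" by (rule R2_conv) (use u in auto)
      from conv_normal[OF this nf] have "?u \<leadsto> [HASH, HALT]" .
      then show "z = 0" using y normal_unique nf by blast
    next
      assume "z = 0"
      then have "?u \<leadsto> [HASH, HALT]" using y by simp
      then show "(?u, [HASH, HALT]) \<in> gen_congruence {..<37} R2"
        using u by (intro rsteps_gen_congruence[OF R2_lists]) (auto simp: R2_def)
    qed
    moreover have "?u \<in> lists {..<37}" using u by fastforce
    ultimately show ?thesis by (simp add: word_class_eq_iff[OF R2_lists])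
  qed
  moreover have "w \<in> lists {..<37}" using w(1) by fastforce
  ultimately show "\<exists>w\<in>lists {..<37}. \<forall>n z. rec_eval f [n] z \<longrightarrow>
      (word_class {..<37} R2 ([HASH, COMMA] @ replicate n ONE @ w) = word_class {..<37} R2 [HASH, HALT]
        \<longleftrightarrow> z = 0)" by blast
qed auto

section \<open>Decidable word problem and undecidable conjugacy problem\<close>

text \<open>Presentations with the relations \<open>b f = f' \<beta>\<close> for a letter \<open>b < N\<close> and a signal
  \<open>N \<le> f < M\<close>, where \<open>f' = sig b f\<close> is again a signal and \<open>\<beta> = out b f\<close> is a word of letters. Moving
  all signals to the left gives unique normal forms.\<close>

locale zappa_szep =
  fixes N M :: nat and sig :: "nat \<Rightarrow> nat \<Rightarrow> nat" and out :: "nat \<Rightarrow> nat \<Rightarrow> nat list"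
  assumes NM: "N \<le> M"
    and closed: "b < N \<Longrightarrow> N \<le> f \<Longrightarrow> f < M \<Longrightarrow> N \<le> sig b f \<and> sig b f < M \<and> set (out b f) \<subseteq> {..<N}"
begin

definition rel :: "(nat list \<times> nat list) set" where
  "rel = (\<lambda>(b, f). ([b, f], sig b f # out b f)) ` ({..<N} \<times> {N..<M})"

text \<open>A transducer reading its word from the right end, with transition function
  \<open>sig\<close> and output \<open>out\<close>. The monoid is the Zappa-Szep product of the free
  monoids on signals and on letters given by these maps.\<close>

primrec pass :: "nat list \<Rightarrow> nat \<Rightarrow> nat \<times> nat list" where
  "pass [] f = (f, [])"
| "pass (b # w) f = (sig b (fst (pass w f)), out b (fst (pass w f)) @ snd (pass w f))"

definition nf_step :: "nat list \<times> nat list \<Rightarrow> nat \<Rightarrow> nat list \<times> nat list" where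
  "nf_step s c = (if c < N then (fst s, snd s @ [c])
     else (fst s @ [fst (pass (snd s) c)], snd (pass (snd s) c)))"

definition nf :: "nat list \<Rightarrow> nat list \<times> nat list" where
  "nf u = foldl nf_step ([], []) u"

abbreviation gen where "gen \<equiv> gen_congruence {..<M} rel"

lemma finite_rel: "finite rel"
  by (simp add: rel_def)

lemma rel_lists: "rel \<subseteq> lists {..<M} \<times> lists {..<M}"
  using closed NM by (fastforce simp: rel_def)

lemma pass_append:
  "pass (w @ w') f = (fst (pass w (fst (pass w' f))), snd (pass w (fst (pass w' f))) @ snd (pass w' f))"
  by (induction w) auto

lemma pass_closed:
  assumes "set w \<subseteq> {..<N}" "N \<le> f" "f < M"
  shows "N \<le> fst (pass w f) \<and> fst (pass w f) < M \<and> set (snd (pass w f)) \<subseteq> {..<N}"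
  using assms(1) by (induction w) (use assms(2,3) closed in auto)

lemma foldl_nf_step_letters: "set v \<subseteq> {..<N} \<Longrightarrow> foldl nf_step s v = (fst s, snd s @ v)"
  by (induction v arbitrary: s) (auto simp: nf_step_def)

lemma foldl_nf_step_signals: "set ps \<subseteq> {N..} \<Longrightarrow> foldl nf_step (qs, []) ps = (qs @ ps, [])"
  by (induction ps arbitrary: qs) (auto simp: nf_step_def)

lemma nf_closed:
  "set u \<subseteq> {..<M} \<Longrightarrow> set (fst (nf u)) \<subseteq> {N..<M} \<and> set (snd (nf u)) \<subseteq> {..<N}"
proof (induction u rule: rev_induct)
  case (snoc c u)
  then show ?case using pass_closed[of "snd (nf u)" c] by (auto simp: nf_def nf_step_def)
qed (simp add: nf_def)

text \<open>Both sides of a relation transform every state of the fold equally, since sending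
  \<open>f\<close> through a word that ends in \<open>b\<close> begins by exchanging
  \<open>b\<close> and \<open>f\<close>.\<close>

lemma nf_gen: assumes "(u, v) \<in> gen" shows "nf u = nf v"
proof (rule gen_congruence_invariant[OF rel_lists _ assms])
  fix l r x y assume "(l, r) \<in> rel"
  then obtain b f where l: "l = [b, f]" "r = sig b f # out b f" "b < N" "N \<le> f" "f < M"
    by (auto simp: rel_def)
  have "foldl nf_step s l = foldl nf_step s r" for s
    using closed[OF l(3-5)] l(3,4) unfolding l(1,2)
    by (simp add: nf_step_def pass_append foldl_nf_step_letters)
  then show "nf (x @ l @ y) = nf (x @ r @ y)" by (simp add: nf_def)
qed

lemma pass_gen:
  assumes "set w \<subseteq> {..<N}" "N \<le> f" "f < M"
  shows "(w @ [f], fst (pass w f) # snd (pass w f)) \<in> gen"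
  using assms(1)
proof (induction w)
  case Nil
  show ?case using gen_congruence_refl[OF rel_lists] assms by simp
next
  case (Cons b w)
  let ?f = "fst (pass w f)" and ?w = "snd (pass w f)"
  have p: "N \<le> ?f \<and> ?f < M \<and> set ?w \<subseteq> {..<M}" "b < N" "b < M"
    using pass_closed[of w f] Cons.prems assms NM by auto
  have "(b # w @ [f], b # ?f # ?w) \<in> gen"
    using gen_congruence_context[OF rel_lists Cons.IH, of "[b]" "[]"] Cons.prems p by simp
  moreover have "([b, ?f], sig b ?f # out b ?f) \<in> gen"
    using p by (intro gen_congruence_rule[OF rel_lists]) (auto simp: rel_def)
  from gen_congruence_context[OF rel_lists this, of "[]" ?w]
  have "(b # ?f # ?w, sig b ?f # out b ?f @ ?w) \<in> gen"
    using p by (simp add: in_lists_conv_set subset_eq)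
  ultimately show ?case using gen_congruence_trans[OF rel_lists] by simp
qed

lemma gen_nf: "set u \<subseteq> {..<M} \<Longrightarrow> (u, fst (nf u) @ snd (nf u)) \<in> gen"
proof (induction u rule: rev_induct)
  case Nil
  show ?case using gen_congruence_refl[OF rel_lists] by (simp add: nf_def)
next
  case (snoc c u)
  let ?p = "fst (nf u)" and ?w = "snd (nf u)"
  have s: "set ?p \<subseteq> {N..<M}" "set ?w \<subseteq> {..<N}" "c < M" using nf_closed[of u] snoc.prems by auto
  have nf: "nf (u @ [c]) = nf_step (nf u) c" by (simp add: nf_def)
  have 1: "(u @ [c], ?p @ ?w @ [c]) \<in> gen"
    using gen_congruence_context[OF rel_lists snoc.IH, of "[]" "[c]"] snoc.prems by simp
  show ?case
  proof (cases "c < N")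
    case False
    then have "(?w @ [c], fst (pass ?w c) # snd (pass ?w c)) \<in> gen"
      using pass_gen[of ?w c] s by simp
    from gen_congruence_context[OF rel_lists this, of ?p "[]"]
    have "(?p @ ?w @ [c], ?p @ fst (pass ?w c) # snd (pass ?w c)) \<in> gen"
      using s by fastforce
    from gen_congruence_trans[OF rel_lists 1 this] show ?thesis
      using False by (simp add: nf nf_step_def)
  qed (use 1 in \<open>simp add: nf nf_step_def\<close>)
qed

lemma gen_iff:
  assumes "set u \<subseteq> {..<M}" "set v \<subseteq> {..<M}"
  shows "(u, v) \<in> gen \<longleftrightarrow> nf u = nf v"
  using nf_gen gen_nf[OF assms(1)] gen_nf[OF assms(2)] gen_congruence_trans[OF rel_lists]
    gen_congruence_sym[OF rel_lists] by metis

lemma word_problem_decidable_rel: "word_problem_decidable {..<M} rel"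
proof -
  obtain t1 where t1: "computable 2 (\<lambda>xs. t1 (xs ! 0) (xs ! 1))" "\<forall>i<N. \<forall>j<M. t1 i j = sig i j"
    using computable_table2[of N M sig] by blast
  obtain t2 where t2: "computable 2 (\<lambda>xs. t2 (xs ! 0) (xs ! 1))"
    "\<forall>i<N. \<forall>j<M. t2 i j = list_encode (out i j)"
    using computable_table2[of N M "\<lambda>i j. list_encode (out i j)"] by blast
  define p where "p st b = prod_encode (t1 b (pfst st),
    list_encode (list_decode (t2 b (pfst st)) @ list_decode (psnd st)))" for st b
  have p_comp: "computable 2 (\<lambda>xs. p (xs ! 0) (xs ! 1))"
    unfolding p_def
    by (intro computable_prod_encode computable_append computable_comp2[OF t1(1)]
        computable_comp2[OF t2(1)] computable_prod_decode computable_nth) auto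
  have p: "foldl p (prod_encode (f, list_encode acc)) rw =
      prod_encode (fst (pass (rev rw) f), list_encode (snd (pass (rev rw) f) @ acc))"
    if "set rw \<subseteq> {..<N}" "N \<le> f" "f < M" for rw f acc
    using that
  proof (induction rw arbitrary: f acc)
    case (Cons b rw)
    have "p (prod_encode (f, list_encode acc)) b = prod_encode (sig b f, list_encode (out b f @ acc))"
      using t1(2) t2(2) Cons.prems by (simp add: p_def)
    then show ?case
      using Cons.IH[of "sig b f" "out b f @ acc"] closed[of b f] Cons.prems
      by (simp add: pass_append)
  qed simp
  \<comment> \<open>The forms \<open>Suc c \<le> N\<close> and \<open>@ list_decode 0\<close> match
    \<open>computable_if_le\<close> and \<open>computable_rev_append\<close>.\<close>
  define q where "q st c = (if Suc c \<le> N then prod_encode (pfst st, list_encode (c # list_decode (psnd st)))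
    else prod_encode
      (list_encode (pfst (foldl p (prod_encode (c, 0)) (list_decode (psnd st))) # list_decode (pfst st)),
       list_encode (rev (list_decode (psnd (foldl p (prod_encode (c, 0)) (list_decode (psnd st)))))
         @ list_decode 0)))" for st c
  have q_comp: "computable 2 (\<lambda>xs. q (xs ! 0) (xs ! 1))"
    unfolding q_def
    by (intro computable_if_le computable_prod_encode computable_list_cons computable_rev_append
        computable_foldl[OF p_comp] computable_prod_decode computable_Suc computable_const
        computable_nth) auto
  \<comment> \<open>Both components are stored in reverse: new letters are then added at the head,
    and a signal meets the last letter first.\<close>
  define code where "code s = prod_encode (list_encode (rev (fst s)), list_encode (rev (snd s)))"
    for s :: "nat list \<times> nat list"
  have q: "q (code s) c = code (nf_step s c)" if "set (snd s) \<subseteq> {..<N}" "c < M" for s c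
    using p[of "rev (snd s)" c "[]"] that
    by (simp add: q_def code_def nf_step_def Suc_le_eq del: list_encode.simps(2))
  have g: "foldl q (prod_encode (0, 0)) u = code (nf u)" if "set u \<subseteq> {..<M}" for u
    using that
  proof (induction u rule: rev_induct)
    case (snoc c u)
    then show ?case using q[of "nf u" c] nf_closed[of u] by (simp add: nf_def)
  qed (simp add: nf_def code_def)
  have code_eq: "code s = code t \<longleftrightarrow> s = t" for s t
    by (auto simp: code_def prod_eq_iff list_encode_eq)
  show ?thesis
    unfolding word_problem_decidable_def
  proof (rule decidable_on_wordsI)
    show "computable 1 (\<lambda>xs. foldl q (prod_encode (0, 0)) (list_decode (xs ! 0)))"
      by (intro computable_foldl[OF q_comp] computable_const computable_nth) auto
    show "word_class {..<M} rel u = word_class {..<M} rel v \<longleftrightarrow>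
        foldl q (prod_encode (0, 0)) (list_decode (list_encode u)) =
        foldl q (prod_encode (0, 0)) (list_decode (list_encode v))"
      if "u \<in> lists {..<M}" "v \<in> lists {..<M}" for u v
      using that gen_iff[of u v]
      by (simp add: word_class_eq_iff[OF rel_lists] g code_eq in_lists_conv_set subset_eq)
  qed
qed

lemma no_zero:
  assumes "N < M" shows "\<nexists>z. is_zero (presented_monoid {..<M} rel) z"
proof (rule no_zeroI[OF rel_lists])
  fix l r assume "(l, r) \<in> rel"
  then obtain b f where l: "l = [b, f]" "r = sig b f # out b f" "b < N" "N \<le> f" "f < M"
    by (auto simp: rel_def)
  then have "filter (\<lambda>c. N \<le> c) (out b f) = []"
    using closed[of b f] by (auto simp: filter_empty_conv)
  then show "length (filter (\<lambda>c. N \<le> c) l) = length (filter (\<lambda>c. N \<le> c) r)"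
    using l closed[of b f] by simp
qed (use assms in auto)

text \<open>The signal itself is the conjugator, because it leaves the word as it entered.\<close>

lemma conj_to_pass:
  assumes "set w \<subseteq> {..<N}" "N \<le> f" "f < M" "pass w f = (f, w')"
  shows "conj_to {..<M} rel w w'"
  using pass_gen[OF assms(1-3)] assms(3,4) unfolding conj_to_def[OF rel_lists]
  by (intro bexI[of _ "[f]"]) auto

text \<open>Let \<open>ps w\<close> be the normal form of the conjugator, so that
  \<open>u ps w = ps w v\<close>. By uniqueness of normal forms the signals \<open>ps\<close> pass
  through \<open>u\<close> and come out as \<open>ps\<close> again, so each of them returns
  unchanged and the word stays in \<open>I\<close>. What remains is a conjugacy
  \<open>u' w = w v\<close> between plain words.\<close>

lemma conj_to_invariant:
  assumes u: "set u \<subseteq> {..<N}" and v: "set v \<subseteq> {..<N}" and conj: "conj_to {..<M} rel u v"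
    and I: "u \<in> I" "\<And>w f w'. w \<in> I \<Longrightarrow> N \<le> f \<Longrightarrow> f < M \<Longrightarrow> pass w f = (f, w') \<Longrightarrow> w' \<in> I"
  shows "\<exists>u'\<in>I. \<exists>w. u' @ w = w @ v"
proof -
  obtain g where g: "set g \<subseteq> {..<M}" "(u @ g, g @ v) \<in> gen"
    using conj unfolding conj_to_def[OF rel_lists] by auto
  define ps w where "ps = fst (nf g)" and "w = snd (nf g)"
  have ps: "set ps \<subseteq> {N..<M}" "set w \<subseteq> {..<N}"
    using nf_closed[OF g(1)] by (auto simp: ps_def w_def)
  have gw: "(g, ps @ w) \<in> gen" using gen_nf[OF g(1)] by (simp add: ps_def w_def)
  have M: "u \<in> lists {..<M}" "v \<in> lists {..<M}" using u v NM by auto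
  have "(u @ ps @ w, u @ g) \<in> gen"
    using gen_congruence_context[OF rel_lists gen_congruence_sym[OF rel_lists gw] M(1), of "[]"] by simp
  moreover have "(g @ v, ps @ w @ v) \<in> gen"
    using gen_congruence_context[OF rel_lists gw _ M(2), of "[]"] by simp
  ultimately have "(u @ ps @ w, ps @ w @ v) \<in> gen"
    using g(2) gen_congruence_trans[OF rel_lists] by blast
  then have eq: "nf (u @ ps @ w) = nf (ps @ w @ v)" by (rule nf_gen)
  have "nf (ps @ w @ v) = (ps, w @ v)"
    using ps v by (simp add: nf_def foldl_nf_step_signals foldl_nf_step_letters subset_eq)
  moreover have "nf (u @ ps @ w) = (let s = foldl nf_step ([], u) ps in (fst s, snd s @ w))"
    using ps u by (simp add: nf_def foldl_nf_step_letters Let_def)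
  ultimately have s: "fst (foldl nf_step ([], u) ps) = [] @ ps"
    "snd (foldl nf_step ([], u) ps) @ w = w @ v"
    using eq by (simp_all add: Let_def)
  have fst_prefix: "\<exists>zs. fst (foldl nf_step s ps) = fst s @ zs \<and> length zs = length ps"
    if "set ps \<subseteq> {N..<M}" for s ps
    using that
  proof (induction ps arbitrary: s)
    case (Cons f ps)
    then have "\<exists>zs. fst (foldl nf_step (nf_step s f) ps) = fst (nf_step s f) @ zs \<and> length zs = length ps"
      by (intro Cons.IH) simp
    moreover have "fst (nf_step s f) = fst s @ [fst (pass (snd s) f)]"
      using Cons.prems by (simp add: nf_step_def)
    ultimately show ?case by auto
  qed simp
  have "snd (foldl nf_step (qs, u) ps) \<in> I"
    if "set ps \<subseteq> {N..<M}" "fst (foldl nf_step (qs, u) ps) = qs @ ps" "u \<in> I" for qs u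
    using that
  proof (induction ps arbitrary: qs u)
    case (Cons f ps)
    obtain f' w' where p: "pass u f = (f', w')" by fastforce
    have step: "nf_step (qs, u) f = (qs @ [f'], w')" using Cons.prems p by (simp add: nf_step_def)
    obtain zs where "fst (foldl nf_step (qs @ [f'], w') ps) = (qs @ [f']) @ zs"
      using fst_prefix[of ps "(qs @ [f'], w')"] Cons.prems by auto
    \<comment> \<open>Signals already emitted are never altered, so the first one to come out must
      be the first one of \<open>f # ps\<close>.\<close>
    then have "f' = f" using Cons.prems(2) step by simp
    then have "w' \<in> I" using I(2)[of u f w'] Cons.prems p by simp
    then show ?case using Cons.IH[of "qs @ [f']" w'] Cons.prems step \<open>f' = f\<close> by simp
  qed simp
  from this[OF ps(1) s(1) I(1)] s(2) show ?thesis by blast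
qed

end

text \<open>Signals: a pass of 36 carries out one parallel rewriting step, where \<open>37 + c\<close> is this signal
  holding back the letter \<open>c\<close> until it has seen whether \<open>c\<close> is the second letter of a redex. The
  remaining ones lead from \<open># HALT\<close> to every \<open># w\<close>: 109 turns \<open># HALT\<close> into \<open># 0\<close> (110 and 111 are its
  states after reading \<open>HALT\<close> as the last letter, resp. anything else), \<open>73 + x\<close> inserts the letter
  \<open>x\<close> after \<open>0\<close>, and 112 erases \<open>0\<close>.\<close>

definition sig :: "nat \<Rightarrow> nat \<Rightarrow> nat" where
  "sig b f =
    (if f < 73 then
       (if b = HASH then 36
        else if f = 36 then 37 + b
        else if rule b (f - 37) = None then 37 + b else 36)
     else if f < 109 \<or> f = 112 then f
     else if b = HASH then 109
     else if f = 109 \<and> b = HALT then 110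
     else 111)"

definition out :: "nat \<Rightarrow> nat \<Rightarrow> nat list" where
  "out b f =
    (if f = 36 then (if b = HASH then [HASH] else [])
     else if f < 73 then
       (case rule b (f - 37) of Some r \<Rightarrow> r | None \<Rightarrow> if b = HASH then [HASH, f - 37] else [f - 37])
     else if f < 109 then (if b = 0 then [0, f - 73] else [b])
     else if f = 112 then (if b = 0 then [] else [b])
     else if f = 110 then (if b = HASH then [HASH, 0] else [b, HALT])
     else if f = 109 \<and> b = HALT then []
     else [b])"

text \<open>There are 36 letters and 1 + 36 + 36 + 4 signals: the empty scanner 36, a scanner 37 +
  \<open>c\<close> and an inserter 73 + \<open>x\<close> for every letter, and 109 to 112.\<close>

interpretation M1: zappa_szep 36 113 sig out
proof
  fix b f :: nat assume "b < 36" "36 \<le> f" "f < 113"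
  moreover have "set r \<subseteq> {..<36}" if "rule b (f - 37) = Some r" for r
    using rule_SomeD[OF that] by auto
  ultimately show "36 \<le> sig b f \<and> sig b f < 113 \<and> set (out b f) \<subseteq> {..<36}"
    by (auto simp: sig_def out_def split: option.splits)
qed simp

section \<open>Computation by a scanning signal\<close>

lemma normal_Cons: "normal (b # w) \<longleftrightarrow> normal w \<and> (w \<noteq> [] \<longrightarrow> rule b (hd w) = None)"
  unfolding normal_iff by (auto simp: Cons_eq_append_conv neq_Nil_conv) blast+

definition held :: "nat \<Rightarrow> nat list" where
  "held f = (if f = 36 then [] else [f - 37])"

text \<open>A pass either performs at least one step or certifies that \<open>w\<close> is normal.
  The clause on signal 36 is needed for the induction: in a normal word the scanner holds no letter
  only at the start or just after \<open>HASH\<close>, and \<open>HASH\<close> cannot be second in a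
  redex, so no redex is missed.\<close>

lemma pass_scan:
  assumes "set w \<subseteq> {..<36}"
  shows "36 \<le> fst (M1.pass w 36) \<and> fst (M1.pass w 36) < 73 \<and>
    (normal w \<and> held (fst (M1.pass w 36)) @ snd (M1.pass w 36) = w \<and>
       (fst (M1.pass w 36) = 36 \<longrightarrow> w = [] \<or> hd w = HASH) \<or>
     rstep\<^sup>+\<^sup>+ w (held (fst (M1.pass w 36)) @ snd (M1.pass w 36)))"
  using assms
proof (induction w)
  case Nil
  show ?case by (auto simp: held_def normal_iff)
next
  case (Cons b w)
  let ?f = "fst (M1.pass w 36)" and ?w = "snd (M1.pass w 36)"
  let ?f' = "sig b ?f" and ?w' = "out b ?f @ ?w"
  have f: "36 \<le> ?f" "?f < 73" using Cons by auto
  have b: "b < 36" using Cons.prems by simp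
  have f': "36 \<le> ?f' \<and> ?f' < 73" using f b by (auto simp: sig_def)
  have step: "rstep\<^sup>+\<^sup>+ (b # held ?f @ ?w) (held ?f' @ ?w') \<or>
      held ?f' @ ?w' = b # held ?f @ ?w \<and> (held ?f \<noteq> [] \<longrightarrow> rule b (hd (held ?f)) = None)"
  proof (cases "?f = 36")
    case True
    then show ?thesis by (auto simp: held_def sig_def out_def)
  next
    case False
    show ?thesis
    proof (cases "rule b (?f - 37)")
      case None
      then show ?thesis using False f by (auto simp: held_def sig_def out_def)
    next
      case (Some r)
      then have "rstep (b # (?f - 37) # ?w) (r @ ?w)" using rstepI[of b "?f - 37" r "[]" ?w] by simp
      then show ?thesis using False f Some by (auto simp: held_def sig_def out_def)
    qed
  qed
  consider (steps) "rstep\<^sup>+\<^sup>+ w (held ?f @ ?w)"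
    | (normal) "normal w" "held ?f @ ?w = w" "?f = 36 \<longrightarrow> w = [] \<or> hd w = HASH"
    using Cons by auto
  then show ?case
  proof cases
    case steps
    have "rstep\<^sup>+\<^sup>+ (b # w) (b # held ?f @ ?w)"
      using steps
    proof (induction rule: tranclp_induct)
      case (base y)
      then show ?case using rstep_context[of w y "[b]" "[]"] by auto
    next
      case (step y z)
      then show ?case using rstep_context[of y z "[b]" "[]"] by auto
    qed
    with step have "rstep\<^sup>+\<^sup>+ (b # w) (held ?f' @ ?w')"
      by (elim disjE conjE) (erule (1) tranclp_trans, simp only:)
    then show ?thesis using f' by simp
  next
    case normal
    show ?thesis
    proof (cases "rstep\<^sup>+\<^sup>+ (b # held ?f @ ?w) (held ?f' @ ?w')")
      case True
      then show ?thesis using f' normal(2) by auto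
    next
      case False
      then have *: "held ?f' @ ?w' = b # w" "held ?f \<noteq> [] \<longrightarrow> rule b (hd (held ?f)) = None"
        using step normal(2) by auto
      have "rule b (hd w) = None" if "w \<noteq> []"
      proof (cases "?f = 36")
        case True
        then show ?thesis using normal(3) that rule_SomeD[of b HASH] by (cases "rule b HASH") auto
      next
        case False
        then have "held ?f \<noteq> []" by (simp add: held_def)
        then show ?thesis using *(2) normal(2) by (metis hd_append2)
      qed
      then have "normal (b # w)" using normal(1) by (simp add: normal_Cons)
      moreover have "?f' = 36 \<longrightarrow> b = HASH"
        using * f b by (auto simp: sig_def held_def split: if_splits)
      ultimately show ?thesis using * f' by simp
    qed
  qed
qed

text \<open>\<open>HASH\<close> is never held back, so the scanner leaves as the signal 36 that
  entered; hence the pass is a conjugation.\<close>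

lemma pass_scan_HASH:
  assumes "set w \<subseteq> {..<36}"
  shows "\<exists>w'. M1.pass (HASH # w) 36 = (36, HASH # w') \<and>
    (normal (HASH # w) \<and> w' = w \<or> rstep\<^sup>+\<^sup>+ (HASH # w) (HASH # w'))"
proof -
  let ?f = "fst (M1.pass w 36)"
  have f: "36 \<le> ?f" "?f < 73" using pass_scan[OF assms] by auto
  have fst: "fst (M1.pass (HASH # w) 36) = 36" using f by (simp add: sig_def)
  have "\<exists>x. out HASH ?f = HASH # x"
  proof (cases "rule HASH (?f - 37)")
    case (Some r)
    then have "r = [HASH, COMMA, SEMI]" by (auto simp: rule_def split: if_splits)
    then show ?thesis using Some f by (simp add: out_def)
  qed (use f in \<open>auto simp: out_def\<close>)
  then obtain w' where w': "snd (M1.pass (HASH # w) 36) = HASH # w'" by auto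
  have "set (HASH # w) \<subseteq> {..<36}" using assms by simp
  from pass_scan[OF this] show ?thesis
    unfolding fst w' by (intro exI[of _ w'] conjI prod_eqI) (use fst w' in \<open>auto simp: held_def\<close>)
qed

lemma random_descent_tranclp:
  assumes "(rstep ^^ n) x z" "normal z" "rstep\<^sup>+\<^sup>+ x y"
  shows "\<exists>k<n. (rstep ^^ k) y z"
proof -
  obtain x' where x': "rstep x x'" "x' \<leadsto> y" using assms(3) by (metis tranclpD)
  obtain m where "n = Suc m" "(rstep ^^ m) x' z" using random_descent[OF assms(1,2) x'(1)] by blast
  then show ?thesis using random_descent_steps[OF _ assms(2) x'(2)] by (metis less_Suc_eq_le)
qed

abbreviation conj1 :: "nat list \<Rightarrow> nat list \<Rightarrow> bool" where
  "conj1 \<equiv> conj_to {..<113} M1.rel"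

lemma tranclp_set: "rstep\<^sup>+\<^sup>+ u v \<Longrightarrow> set u \<subseteq> {1..<36} \<Longrightarrow> set v \<subseteq> {1..<36}"
  by (metis tranclp_into_rtranclp rsteps_set)

text \<open>Every pass that changes the word performs at least one step, and by random descent it
  lowers the number of steps still to do, whichever redexes it selects.\<close>

lemma conj1_normal_form:
  assumes "(rstep ^^ n) (HASH # w) z" "normal z" "set w \<subseteq> {1..<36}"
  shows "conj1 (HASH # w) z"
  using assms(1,3)
proof (induction n arbitrary: w rule: less_induct)
  case (less n)
  have sub: "set w \<subseteq> {..<36}" using less.prems(2) by fastforce
  obtain w' where w': "M1.pass (HASH # w) 36 = (36, HASH # w')"
    "normal (HASH # w) \<and> w' = w \<or> rstep\<^sup>+\<^sup>+ (HASH # w) (HASH # w')"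
    using pass_scan_HASH[OF sub] by blast
  from w'(2) show ?case
  proof
    assume "normal (HASH # w) \<and> w' = w"
    then have "z = HASH # w"
      using less.prems(1) by (cases n) (auto simp: normal_def dest!: relpowp_Suc_D2 simp del: relpowp.simps(2))
    moreover have "HASH # w \<in> lists {..<113}" using sub by fastforce
    ultimately show ?thesis using conj_to_refl[OF M1.rel_lists] by simp
  next
    assume steps: "rstep\<^sup>+\<^sup>+ (HASH # w) (HASH # w')"
    obtain k where "k < n" "(rstep ^^ k) (HASH # w') z"
      using random_descent_tranclp[OF less.prems(1) assms(2) steps] by blast
    moreover have "set w' \<subseteq> {1..<36}" using tranclp_set[OF steps] less.prems(2) by simp
    ultimately have "conj1 (HASH # w') z" by (rule less.IH)
    moreover have "conj1 (HASH # w) (HASH # w')"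
      by (rule M1.conj_to_pass[OF _ _ _ w'(1)]) (use sub in auto)
    ultimately show ?thesis using conj_to_trans[OF M1.rel_lists] by blast
  qed
qed

section \<open>From the halting word back to every word\<close>

lemma pass_letter_free:
  assumes "0 \<notin> set w" "73 \<le> f \<and> f < 109 \<or> f = 112"
  shows "M1.pass w f = (f, w)"
  using assms(1) by (induction w) (use assms(2) in \<open>auto simp: sig_def out_def\<close>)

text \<open>This settles one of the two directions of \<open>c\<close>-conjugacy once and for all.
  The word \<open>w\<close> is built from its last letter on, since every insertion takes place
  directly behind the letter 0.\<close>

lemma conj1_generate:
  assumes "set w \<subseteq> {1..<36}"
  shows "conj1 [HASH, HALT] (HASH # w)"
proof -
  note trans = conj_to_trans[OF M1.rel_lists]
  have sub: "set w \<subseteq> {..<36}" "0 \<notin> set w" using assms by auto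
  have "conj1 [HASH, HALT] [HASH, 0]"
    by (rule M1.conj_to_pass[of _ 109]) (auto simp: sig_def out_def)
  moreover have "conj1 [HASH, 0] (HASH # 0 # w)"
    using assms
  proof (induction w)
    case Nil
    show ?case by (rule conj_to_refl[OF M1.rel_lists]) auto
  next
    case (Cons a w)
    have a: "a < 36" "0 \<notin> set w" using Cons.prems by auto
    have "M1.pass (HASH # 0 # w) (73 + a) = (73 + a, HASH # 0 # a # w)"
      using pass_letter_free[OF a(2), of "73 + a"] a by (simp add: sig_def out_def)
    then have "conj1 (HASH # 0 # w) (HASH # 0 # a # w)"
      by (rule M1.conj_to_pass[rotated 3]) (use Cons.prems in auto)
    then show ?case using trans Cons by auto
  qed
  moreover have "conj1 (HASH # 0 # w) (HASH # w)"
  proof (rule M1.conj_to_pass[of _ 112])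
    show "M1.pass (HASH # 0 # w) 112 = (112, HASH # w)"
      using pass_letter_free[OF sub(2), of 112] by (simp add: sig_def out_def)
  qed (use sub in auto)
  ultimately show ?thesis using trans by blast
qed

section \<open>Only a halting computation leads to the halting word\<close>

lemma rsteps_HASH:
  assumes "HASH # w \<leadsto> v" "HASH \<notin> set w"
  shows "\<exists>w'. v = HASH # w' \<and> HASH \<notin> set w'"
  using assms(1)
proof (induction rule: rtranclp_induct)
  case (step v v')
  then obtain w' where w': "v = HASH # w'" "HASH \<notin> set w'" by blast
  from step(2) show ?case
  proof cases
    case (rstepI p q r x y)
    show ?thesis
    proof (cases x)
      case Nil
      then have "r = [HASH, COMMA, SEMI]" "HASH \<notin> set y"
        using rstepI w' by (auto simp: rule_def split: if_splits)
      then show ?thesis using rstepI Nil by auto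
    next
      case (Cons a x')
      then have "p \<noteq> HASH" "q \<noteq> HASH" using rstepI w' by auto
      then have "HASH \<notin> set r"
        using rstepI(3) by (auto simp: rule_def split: if_splits)
      then show ?thesis using rstepI w' Cons by auto
    qed
  qed
qed (use assms(2) in blast)

lemma pass_scan_range: "36 \<le> f \<Longrightarrow> f < 73 \<Longrightarrow> set w \<subseteq> {..<36} \<Longrightarrow>
    36 \<le> fst (M1.pass w f) \<and> fst (M1.pass w f) < 73"
  by (induction w) (auto simp: sig_def)

lemma pass_halt:
  assumes "HASH \<notin> set w"
  shows "M1.pass w 109 = (if w = [] then (109, []) else if w = [HALT] then (110, []) else (111, w))"
  using assms by (induction w) (auto simp: sig_def out_def)

lemma fst_pass_halt: "109 \<le> f \<Longrightarrow> f \<le> 111 \<Longrightarrow> 109 \<le> fst (M1.pass w f) \<and> fst (M1.pass w f) \<le> 111"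
  by (induction w) (auto simp: sig_def)

text \<open>The reducts of \<open>HASH # w\<close> are closed under all passes whose signal returns
  unchanged. Loaded scanners become 36 at \<open>HASH\<close>, and 110 and 111 become 109, so none
  of these return; inserters and 112 do nothing without the letter 0; 109 acts only on
  \<open>[HASH, HALT]\<close>, which is not a reduct.\<close>

lemma not_conj1:
  assumes w: "HASH # w \<leadsto> y" "normal y" "y \<noteq> [HASH, HALT]" "set w \<subseteq> {1..<36} - {HASH}"
  shows "\<not> conj1 (HASH # w) [HASH, HALT]"
proof
  assume conj: "conj1 (HASH # w) [HASH, HALT]"
  have nf: "normal [HASH, HALT]" by (auto simp: normal_iff Cons_eq_append_conv)
  define I where "I = {v. HASH # w \<leadsto> v}"
  have no: "[HASH, HALT] \<notin> I" using normal_unique w nf unfolding I_def by blast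
  have I: "\<exists>x. v = HASH # x \<and> HASH \<notin> set x \<and> set x \<subseteq> {1..<36}" if "v \<in> I" for v
    using rsteps_HASH[of w v] rsteps_set[of "HASH # w" v] that w(4) by (fastforce simp: I_def)
  have closed: "v' \<in> I" if v: "v \<in> I" "36 \<le> f" "f < 113" "M1.pass v f = (f, v')" for v f v'
  proof -
    obtain x where x: "v = HASH # x" "HASH \<notin> set x" "set x \<subseteq> {1..<36}" using I[OF v(1)] by blast
    have sub: "set x \<subseteq> {..<36}" "0 \<notin> set x" using x(3) by auto
    have fst: "sig HASH (fst (M1.pass x f)) = f" using v(4) x(1) by simp
    consider "f = 36" | "37 \<le> f" "f < 73" | "73 \<le> f \<and> f < 109 \<or> f = 112" | "f = 109"
      | "f = 110 \<or> f = 111"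
      using v(2,3) by linarith
    then show ?thesis
    proof cases
      case 1
      obtain x' where "M1.pass (HASH # x) 36 = (36, HASH # x')"
        "normal (HASH # x) \<and> x' = x \<or> rstep\<^sup>+\<^sup>+ (HASH # x) (HASH # x')"
        using pass_scan_HASH[OF sub(1)] by blast
      then show ?thesis
        using v 1 x(1) unfolding I_def by (auto dest: tranclp_into_rtranclp rtranclp_trans)
    next
      case 2
      then show ?thesis using pass_scan_range[of f x] sub fst by (auto simp: sig_def)
    next
      case 3
      then have "M1.pass v f = (f, v)" using pass_letter_free[of v f] sub x(1) by auto
      then show ?thesis using v by simp
    next
      case 4
      have "x \<noteq> [HALT]" using no v(1) x(1) by auto
      then have "M1.pass v f = (f, v)" using pass_halt[OF x(2)] x(1) 4 by (auto simp: sig_def out_def)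
      then show ?thesis using v by simp
    next
      case 5
      then show ?thesis using fst_pass_halt[of f x] fst by (auto simp: sig_def split: if_splits)
    qed
  qed
  have "HASH # w \<in> I" by (simp add: I_def)
  moreover have "set (HASH # w) \<subseteq> {..<36}" "set [HASH, HALT] \<subseteq> {..<36}" using w(4) by auto
  ultimately have "\<exists>u'\<in>I. \<exists>x. u' @ x = x @ [HASH, HALT]"
    by (intro M1.conj_to_invariant[OF _ _ conj]) (assumption+, rule closed)
  then obtain u' x where u': "u' \<in> I" "u' @ x = x @ [HASH, HALT]" by blast
  \<comment> \<open>In the free monoid, conjugate words have the same length and the same letters;
    the leading \<open>HASH\<close> of \<open>u'\<close> then determines their order.\<close>
  obtain c where c: "u' = HASH # c" using I[OF u'(1)] by blast
  have "length c = 1" using arg_cong[OF u'(2), of length] c by simp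
  then obtain a where a: "c = [a]" by (auto simp: length_Suc_conv)
  have "a = HALT"
    using arg_cong[OF u'(2), of "\<lambda>l. length (filter (\<lambda>b. b = HALT) l)"] c a by (auto split: if_splits)
  then have "u' = [HASH, HALT]" using c a by simp
  then show False using u'(1) no by simp
qed

lemma not_c_conjugacy_decidable_M1: "\<not> c_conjugacy_problem_decidable {..<113} M1.rel"
  unfolding c_conjugacy_problem_decidable_def
proof (rule not_decidable_on_words[where c = "[HASH, COMMA]" and x = ONE and v = "[HASH, HALT]"])
  fix f
  obtain w where w: "set w \<subseteq> {1..<36} - {HASH}" "\<And>n z. rec_eval f [n] z \<Longrightarrow>
      \<exists>y. HASH # COMMA # replicate n ONE @ w \<leadsto> y \<and> normal y \<and> (y = [HASH, HALT] \<longleftrightarrow> z = 0)"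
    using simulation[of f] by blast
  have "c_conjugate (presented_monoid {..<113} M1.rel)
      (word_class {..<113} M1.rel ([HASH, COMMA] @ replicate n ONE @ w))
      (word_class {..<113} M1.rel [HASH, HALT]) \<longleftrightarrow> z = 0" if z: "rec_eval f [n] z" for n z
  proof -
    let ?w = "COMMA # replicate n ONE @ w"
    have s: "set ?w \<subseteq> {1..<36} - {HASH}" "set ?w \<subseteq> {1..<36}" using w(1) by auto
    obtain y where y: "HASH # ?w \<leadsto> y" "normal y" "y = [HASH, HALT] \<longleftrightarrow> z = 0" using w(2)[OF z] by blast
    have "conj1 (HASH # ?w) [HASH, HALT] \<longleftrightarrow> z = 0"
    proof
      show "conj1 (HASH # ?w) [HASH, HALT] \<Longrightarrow> z = 0" using not_conj1[OF y(1,2) _ s(1)] y(3) by blast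
      assume "z = 0"
      then obtain k where "(rstep ^^ k) (HASH # ?w) [HASH, HALT]" "normal [HASH, HALT]"
        using y by (auto dest: rtranclp_imp_relpowp)
      then show "conj1 (HASH # ?w) [HASH, HALT]" using conj1_normal_form s(2) by blast
    qed
    moreover have "HASH # ?w \<in> lists {..<113}" using s(2) by fastforce
    ultimately show ?thesis
      using c_conjugate_iff[OF M1.rel_lists M1.no_zero, of "HASH # ?w" "[HASH, HALT]"]
        conj1_generate[OF s(2)] by simp
  qed
  moreover have "w \<in> lists {..<113}" using w(1) by fastforce
  ultimately show "\<exists>w\<in>lists {..<113}. \<forall>n z. rec_eval f [n] z \<longrightarrow>
      c_conjugate (presented_monoid {..<113} M1.rel)
        (word_class {..<113} M1.rel ([HASH, COMMA] @ replicate n ONE @ w))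
        (word_class {..<113} M1.rel [HASH, HALT]) = (z = 0)" by blast
qed auto

theorem theorem5p2:
  shows "(\<exists>\<Sigma>\<^sub>1 R\<^sub>1. finite_presentation \<Sigma>\<^sub>1 R\<^sub>1 \<and>
            word_problem_decidable \<Sigma>\<^sub>1 R\<^sub>1 \<and> \<not> c_conjugacy_problem_decidable \<Sigma>\<^sub>1 R\<^sub>1) \<and>
         (\<exists>\<Sigma>\<^sub>2 R\<^sub>2. finite_presentation \<Sigma>\<^sub>2 R\<^sub>2 \<and>
            c_conjugacy_problem_decidable \<Sigma>\<^sub>2 R\<^sub>2 \<and> \<not> word_problem_decidable \<Sigma>\<^sub>2 R\<^sub>2)"
proof
  have "finite_presentation {..<113} M1.rel"
    unfolding finite_presentation_def using M1.finite_rel M1.rel_lists by blast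
  then show "\<exists>\<Sigma>\<^sub>1 R\<^sub>1. finite_presentation \<Sigma>\<^sub>1 R\<^sub>1 \<and>
      word_problem_decidable \<Sigma>\<^sub>1 R\<^sub>1 \<and> \<not> c_conjugacy_problem_decidable \<Sigma>\<^sub>1 R\<^sub>1"
    using M1.word_problem_decidable_rel not_c_conjugacy_decidable_M1 by blast
  have "finite_presentation {..<37} R2"
    unfolding finite_presentation_def using finite_R2 R2_lists by blast
  then show "\<exists>\<Sigma>\<^sub>2 R\<^sub>2. finite_presentation \<Sigma>\<^sub>2 R\<^sub>2 \<and>
      c_conjugacy_problem_decidable \<Sigma>\<^sub>2 R\<^sub>2 \<and> \<not> word_problem_decidable \<Sigma>\<^sub>2 R\<^sub>2"
    using c_conjugacy_decidable_R2 not_word_problem_decidable_R2 by blast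
qed

end
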